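(* For $a\in(0,1/5]$ let $\Lambda_a\subset\mathbb R^2$ be the attractor of the IFS $\mathcal F_a=\{f_1,\dots,f_5\}$ defined by $$f_1(\underline x)=A\underline x,\quad f_2(\underline x)=A\underline x+\begin{pmatrix} 1/3 \\ a+d \end{pmatrix},\quad f_3(\underline x)=A^-\underline x+\begin{pmatrix} 2/3 \\ 2(a+d) \end{pmatrix},$$ $$f_4(\underline x)=A\underline x+\begin{pmatrix} 1/3 \\ 3a+2d \end{pmatrix},\quad f_5(\underline x)=A\underline x+\begin{pmatrix} 2/3 \\ 4a+3d \end{pmatrix},$$ where $d=(1-5a)/4$, $A=\begin{pmatrix} 1/3 & 0 \\ d & a \end{pmatrix}$ and $A^-=\begin{pmatrix} -1/3 & 0 \\ 0 & a \end{pmatrix}$. Then for every $a\in(0,1/5]$ the Hausdorff and box dimension of $\Lambda_a$ are given by the following functions of $a$, which are continuous and strictly increasing: $$\frac1{\log3}\cdot\log\left(2+3^{\frac{\log3}{-\log a}}\right)=\dim_{\rm H}\Lambda_a<\dim_{\rm B}\Lambda_a=1+\frac{\log(3/5)}{\log a} .$$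
   Context: The attractor of an IFS $\{f_i\}$ of contracting affine maps is the unique nonempty compact set $\Lambda$ with $\Lambda=\bigcup_if_i(\Lambda)$. $\dim_{\rm H}$ and $\dim_{\rm B}$ denote Hausdorff and box-counting dimension. *)

theory Defs
  imports "HOL-Analysis.Analysis"
begin

text \<open>There is exactly one such set when \<open>F\<close> is a finite nonempty set of contractions of a
  complete metric space.\<close>

definition attractor :: "('a::metric_space \<Rightarrow> 'a) set \<Rightarrow> 'a set" where
  "attractor F = (THE S. S \<noteq> {} \<and> compact S \<and> S = (\<Union>f\<in>F. f ` S))"

text \<open>The summand \<open>(diam U)^s\<close> of the Hausdorff sums, with the usual conventions at \<open>s = 0\<close>:
  the empty set contributes 0 and every nonempty set contributes 1
  (whereas \<open>powr\<close> has \<open>0 powr 0 = 0\<close>).\<close>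

definition diam_pow :: "real \<Rightarrow> 'a::metric_space set \<Rightarrow> ennreal" where
  "diam_pow s U =
     (if U = {} then 0 else if s = 0 then 1 else ennreal (diameter U powr s))"

text \<open>In the next two definitions the covering sets are required to be bounded because
  \<open>diameter\<close> is a junk value on unbounded sets.\<close>

definition hausdorff_premeasure :: "real \<Rightarrow> real \<Rightarrow> 'a::metric_space set \<Rightarrow> ennreal" where
  "hausdorff_premeasure s \<delta> S =
     (INF U \<in> {U :: nat \<Rightarrow> 'a set. S \<subseteq> (\<Union>i. U i) \<and> (\<forall>i. bounded (U i) \<and> diameter (U i) \<le> \<delta>)}.
        (\<Sum>i. diam_pow s (U i)))"

definition hausdorff_measure :: "real \<Rightarrow> 'a::metric_space set \<Rightarrow> ennreal" where
  "hausdorff_measure s S = (SUP \<delta> \<in> {0<..}. hausdorff_premeasure s \<delta> S)"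

definition hausdorff_dim :: "'a::metric_space set \<Rightarrow> ereal" where
  "hausdorff_dim S = (INF s \<in> {s. 0 \<le> s \<and> hausdorff_measure s S = 0}. ereal s)"

text \<open>The least number of sets of diameter at most \<open>\<delta>\<close> that cover \<open>S\<close>; meaningful for
  totally bounded \<open>S\<close>.\<close>

definition covering_number :: "real \<Rightarrow> 'a::metric_space set \<Rightarrow> nat" where
  "covering_number \<delta> S =
     (LEAST n. \<exists>C. finite C \<and> card C = n \<and> S \<subseteq> \<Union>C \<and> (\<forall>U\<in>C. bounded U \<and> diameter U \<le> \<delta>))"

definition lower_box_dim :: "'a::metric_space set \<Rightarrow> ereal" where
  "lower_box_dim S =
     Liminf (at_right 0) (\<lambda>\<delta>. ereal (ln (real (covering_number \<delta> S)) / (- ln \<delta>)))"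

definition upper_box_dim :: "'a::metric_space set \<Rightarrow> ereal" where
  "upper_box_dim S =
     Limsup (at_right 0) (\<lambda>\<delta>. ereal (ln (real (covering_number \<delta> S)) / (- ln \<delta>)))"

text \<open>The box dimension is the common value of the lower and upper box dimensions;
  \<open>box_dim\<close> is only to be read as such when \<open>has_box_dim\<close> holds.\<close>

definition has_box_dim :: "'a::metric_space set \<Rightarrow> bool" where
  "has_box_dim S \<longleftrightarrow> lower_box_dim S = upper_box_dim S"

definition box_dim :: "'a::metric_space set \<Rightarrow> ereal" where
  "box_dim S = upper_box_dim S"

definition d_par :: "real \<Rightarrow> real" where
  "d_par a = (1 - 5 * a) / 4"

text \<open>Matrices are given by their rows.\<close>

definition A_mat :: "real \<Rightarrow> real^2^2" where
  "A_mat a = vector [vector [1/3, 0], vector [d_par a, a]]"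

definition A_minus_mat :: "real \<Rightarrow> real^2^2" where
  "A_minus_mat a = vector [vector [-1/3, 0], vector [0, a]]"

definition ifs :: "real \<Rightarrow> (real^2 \<Rightarrow> real^2) set" where
  "ifs a = (let d = d_par a in
    {\<lambda>x. A_mat a *v x,
     \<lambda>x. A_mat a *v x + vector [1/3, a + d],
     \<lambda>x. A_minus_mat a *v x + vector [2/3, 2 * (a + d)],
     \<lambda>x. A_mat a *v x + vector [1/3, 3 * a + 2 * d],
     \<lambda>x. A_mat a *v x + vector [2/3, 4 * a + 3 * d]})"

definition Lambda :: "real \<Rightarrow> (real^2) set" where
  "Lambda a = attractor (ifs a)"

end

theory Submission
  imports Defs
begin

text \<open>
  The five maps contract by \<open>1/3\<close> horizontally and by \<open>a < 1/3\<close> vertically. In the horizontal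
  direction they lie over three columns, which carry one, three and one of them. The attractor
  thus has the combinatorics of a Bedford-McMullen carpet, and both dimensions are found by
  counting approximate squares: the part of a cylinder of level \<open>n\<close> (thickness \<open>a ^ n\<close>) that lies
  over a triadic column of level \<open>m\<close> with \<open>3 ^ (- m)\<close> comparable to \<open>a ^ n\<close>. Two features differ
  from a carpet. The shear \<open>d\<close> tilts the cylinders, but their
  slopes stay bounded (\<open>zword_2_diff\<close>), so approximate squares still have diameter about \<open>a ^ n\<close>.
  The third map reverses the horizontal direction, but this exchanges the two outer columns, which
  carry the same number of maps (\<open>column_word\<close>). The five images of the unit square lie in five
  consecutive horizontal strips; hence cylinders of the same level are separated on each
  vertical line, and a set of diameter at most \<open>a ^ n\<close> meets boundedly many approximate squares
  (\<open>card_blocks_met\<close>).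

  Box dimension. There are \<open>5 ^ n * 3 ^ (m - n)\<close> approximate squares of level \<open>n\<close> and each of them
  contains a point of the attractor, so covering numbers equal this count up to a constant factor.

  Hausdorff dimension, upper bound. Let \<open>\<theta> = ln 3 / (- ln a)\<close>, the limit of \<open>n / m\<close>, and let
  \<open>Z = 2 + 3 powr \<theta>\<close>. McMullen's measure gives a letter the mass \<open>N powr (\<theta> - 1) / Z\<close>, where \<open>N\<close> is
  the number of maps over its column. An approximate square then has mass
  \<open>3 powr (\<theta> * S m - S n) / Z ^ m\<close>, where \<open>S i\<close> counts the middle letters among the first \<open>i\<close>. Since
  \<open>S i / i\<close> is bounded, it cannot drop by a fixed amount in every step from \<open>n\<close> to \<open>m\<close>. Hence
  every point lies in infinitely many squares of mass at least \<open>(3 powr - e / Z) ^ m\<close>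
  (\<open>infinitely_often_heavy\<close>). As masses add up to 1, there are few such squares, and they cover.

  Hausdorff dimension, lower bound. The law of large numbers for McMullen's measure is replaced by
  a pigeonhole argument: for a large block length \<open>k\<close>, the words of length \<open>k\<close> with a suitable
  number \<open>j\<close> of middle letters carry at least a fraction \<open>1 / (k + 1)\<close> of the mass
  (\<open>large_typed_words\<close>). The points coded by sequences of such blocks form a subset with uniform
  fibres. There normalized counting of words gives all approximate squares of one level the same
  mass up to a constant factor, and a mass distribution principle for counting measures applies.

  Finally, the Hausdorff dimension is the smaller one by strict concavity of \<open>x powr \<theta>\<close>, applied to
  the average of the column sizes \<open>1, 3, 1\<close>.
\<close>

section \<open>Hausdorff measures and dimension\<close>

text \<open>A cover may be indexed by any countable set, because indices that are not used can be given
  the empty set, which contributes 0 to the Hausdorff sum. Bounding the finite subsums avoids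
  infinite sums over such an index set.\<close>

lemma hausdorff_premeasure_le:
  fixes U :: "'i::countable \<Rightarrow> 'a::metric_space set"
  assumes cover: "S \<subseteq> (\<Union>i\<in>I. U i)"
    and small: "\<And>i. i \<in> I \<Longrightarrow> bounded (U i) \<and> diameter (U i) \<le> \<delta>" and \<delta>: "0 \<le> \<delta>"
    and sums: "\<And>F. finite F \<Longrightarrow> F \<subseteq> I \<Longrightarrow> (\<Sum>i\<in>F. diam_pow s (U i)) \<le> B"
  shows "hausdorff_premeasure s \<delta> S \<le> B"
proof -
  define V where "V k = (if k \<in> to_nat ` I then U (from_nat k) else {})" for k
  have V: "S \<subseteq> (\<Union>k. V k) \<and> (\<forall>k. bounded (V k) \<and> diameter (V k) \<le> \<delta>)"
  proof (intro conjI allI)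
    show "S \<subseteq> (\<Union>k. V k)"
    proof
      fix x assume "x \<in> S"
      then obtain i where "i \<in> I" "x \<in> U i" using cover by blast
      then have "x \<in> V (to_nat i)" by (simp add: V_def)
      then show "x \<in> (\<Union>k. V k)" by blast
    qed
    show "bounded (V k)" "diameter (V k) \<le> \<delta>" for k
      using small \<delta> by (auto simp: V_def)
  qed
  have "(\<Sum>k<n. diam_pow s (V k)) \<le> B" for n
  proof -
    define F where "F = {i \<in> I. to_nat i < n}"
    have inj: "inj_on to_nat F" by (simp add: inj_on_def)
    have sub: "to_nat ` F \<subseteq> {..<n}" by (auto simp: F_def)
    have fin: "finite F" using finite_imageD[OF finite_subset[OF sub] inj] by simp
    have "(\<Sum>k<n. diam_pow s (V k)) = (\<Sum>k\<in>to_nat ` F. diam_pow s (V k))"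
      by (rule sum.mono_neutral_right) (use sub in \<open>auto simp: V_def F_def diam_pow_def\<close>)
    also have "\<dots> = (\<Sum>i\<in>F. diam_pow s (V (to_nat i)))"
      by (simp add: sum.reindex[OF inj])
    also have "\<dots> = (\<Sum>i\<in>F. diam_pow s (U i))"
      by (rule sum.cong) (auto simp: V_def F_def)
    also have "\<dots> \<le> B" using sums[OF fin] by (auto simp: F_def)
    finally show ?thesis .
  qed
  then have "(\<Sum>k. diam_pow s (V k)) \<le> B"
    by (intro suminf_le_const) auto
  then show ?thesis
    unfolding hausdorff_premeasure_def using V by (intro INF_lower2[of V]) auto
qed

lemma hausdorff_measure_eq_0I:
  assumes "\<And>\<delta> e. 0 < \<delta> \<Longrightarrow> 0 < e \<Longrightarrow> hausdorff_premeasure s \<delta> S \<le> ennreal e"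
  shows "hausdorff_measure s S = 0"
proof -
  have "hausdorff_premeasure s \<delta> S \<le> 0" if "\<delta> > 0" for \<delta>
    by (rule ennreal_le_epsilon) (simp add: assms[OF that])
  then show ?thesis unfolding hausdorff_measure_def
    by (intro antisym SUP_least) auto
qed

lemma hausdorff_dim_eqI:
  assumes "0 \<le> t"
    and upper: "\<And>s. t < s \<Longrightarrow> hausdorff_measure s S = 0"
    and lower: "\<And>s. 0 \<le> s \<Longrightarrow> s < t \<Longrightarrow> hausdorff_measure s S \<noteq> 0"
  shows "hausdorff_dim S = ereal t"
proof (rule antisym)
  show "ereal t \<le> hausdorff_dim S"
    unfolding hausdorff_dim_def using lower by (intro INF_greatest) force
  show "hausdorff_dim S \<le> ereal t"
  proof (rule ereal_le_epsilon2)
    fix e :: real assume "e > 0"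
    then have "t + e \<in> {s. 0 \<le> s \<and> hausdorff_measure s S = 0}"
      using assms(1) upper[of "t + e"] by auto
    then have "hausdorff_dim S \<le> ereal (t + e)"
      unfolding hausdorff_dim_def by (rule INF_lower)
    then show "hausdorff_dim S \<le> ereal t + ereal e" by simp
  qed
qed

text \<open>A covering set is later replaced by an open neighbourhood, so there must be room above its
  diameter at little cost. At \<open>s = 0\<close> this relies on the convention that a nonempty set contributes
  1 even if its diameter is 0.\<close>

lemma diam_pow_enlarge:
  assumes "U \<noteq> {}" and "0 \<le> s" and "0 < e"
  obtains \<rho> where "diameter U < \<rho>" and "0 < \<rho>" and "ennreal (\<rho> powr s) \<le> diam_pow s U + ennreal e"
proof (cases "s = 0")
  case True
  show ?thesis
    by (rule that[of "max (diameter U) 0 + 1"]) (use True assms in \<open>auto simp: diam_pow_def\<close>)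
next
  case False
  define r where "r = max (diameter U) 0"
  have "((\<lambda>\<rho>. \<rho> powr s) \<longlongrightarrow> r powr s) (at_right r)"
    using False assms(2)
    by (intro tendsto_powr2 tendsto_intros) (auto simp: r_def eventually_at_filter)
  then have "eventually (\<lambda>\<rho>. \<rho> powr s < r powr s + e) (at_right r)"
    using assms(3) by (intro order_tendstoD) auto
  moreover have "eventually (\<lambda>\<rho>. r < \<rho>) (at_right r)" by (rule eventually_at_right_less)
  ultimately have "eventually (\<lambda>\<rho>. \<rho> powr s < r powr s + e \<and> r < \<rho>) (at_right r)"
    by eventually_elim auto
  then obtain \<rho> where \<rho>: "\<rho> powr s < r powr s + e" "r < \<rho>"
    using eventually_happens'[OF trivial_limit_at_right_real] by blast
  have "ennreal (r powr s) \<le> diam_pow s U"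
    using assms(1,2) False by (auto simp: diam_pow_def r_def max_def)
  then have "ennreal (r powr s) + ennreal e \<le> diam_pow s U + ennreal e"
    by (rule add_right_mono)
  moreover have "ennreal (\<rho> powr s) \<le> ennreal (r powr s) + ennreal e"
    using \<rho>(1) assms(3) ennreal_leI[of "\<rho> powr s" "r powr s + e"] by simp
  ultimately show ?thesis
    using \<rho>(2) by (intro that[of \<rho>]) (auto simp: r_def intro: order_trans)
qed

text \<open>The normalized counting measures on the finite sets of points \<open>\<pi> T i\<close> take the place of a
  limit measure on \<open>S\<close>. By compactness a countable cover may be replaced by a finite one with open
  sets, and then one large \<open>T\<close> serves all of its members at once: they exhaust \<open>X T\<close>, so the sum of
  the \<open>\<rho> i powr s\<close> is at least \<open>1 / C\<close>.\<close>

lemma mass_distribution_principle: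
  fixes S :: "'a::metric_space set" and X :: "nat \<Rightarrow> 'i set" and \<pi> :: "nat \<Rightarrow> 'i \<Rightarrow> 'a"
  assumes "compact S" and s: "0 \<le> s"
    and X: "\<And>T. finite (X T)" "\<And>T. X T \<noteq> {}"
    and \<pi>: "\<And>T i. i \<in> X T \<Longrightarrow> \<pi> T i \<in> S"
    and C: "0 < C"
    and mass: "\<And>\<rho>. 0 < \<rho> \<Longrightarrow> \<exists>T0. \<forall>T\<ge>T0. \<forall>V. (\<forall>x\<in>V. \<forall>y\<in>V. dist x y \<le> \<rho>) \<longrightarrow>
      real (card {i \<in> X T. \<pi> T i \<in> V}) \<le> C * \<rho> powr s * real (card (X T))"
  shows "hausdorff_measure s S \<noteq> 0"
proof
  assume "hausdorff_measure s S = 0"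
  then have "hausdorff_premeasure s 1 S \<le> 0"
    unfolding hausdorff_measure_def by (metis SUP_upper greaterThan_iff zero_less_one)
  then have "hausdorff_premeasure s 1 S < ennreal (1 / (2 * C))" using C
    by (auto simp: ennreal_less_zero_iff)
  then obtain U where U: "S \<subseteq> (\<Union>i::nat. U i)" "\<And>i. bounded (U i)"
      and sumU: "(\<Sum>i. diam_pow s (U i)) < ennreal (1 / (2 * C))"
    unfolding hausdorff_premeasure_def INF_less_iff by blast
  \<comment> \<open>The total enlargement \<open>1 / (4 * C)\<close> keeps the sum below \<open>3 / (4 * C)\<close>.\<close>
  define e where "e i = (1 / (4 * C)) * (1/2) ^ Suc i" for i
  have e: "e i > 0" for i using C by (simp add: e_def)
  have "\<forall>i. U i \<noteq> {} \<longrightarrow> (\<exists>\<rho>. diameter (U i) < \<rho> \<and> 0 < \<rho> \<and>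
      ennreal (\<rho> powr s) \<le> diam_pow s (U i) + ennreal (e i))"
    using diam_pow_enlarge[OF _ s e] by metis
  then obtain \<rho> where \<rho>: "\<And>i. U i \<noteq> {} \<Longrightarrow> diameter (U i) < \<rho> i"
     "\<And>i. U i \<noteq> {} \<Longrightarrow> 0 < \<rho> i"
     "\<And>i. U i \<noteq> {} \<Longrightarrow> ennreal (\<rho> i powr s) \<le> diam_pow s (U i) + ennreal (e i)"
    by metis
  define V where "V i = (\<Union>x\<in>U i. ball x ((\<rho> i - diameter (U i)) / 2))" for i
  have V_diam: "dist x y \<le> \<rho> i" if xy: "x \<in> V i" "y \<in> V i" for x y i
  proof -
    obtain x' y' where x': "x' \<in> U i" "dist x' x < (\<rho> i - diameter (U i)) / 2"
      and y': "y' \<in> U i" "dist y' y < (\<rho> i - diameter (U i)) / 2"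
      using xy unfolding V_def UN_iff mem_ball by blast
    have "dist x' y' \<le> diameter (U i)" using x' y' U(2) by (intro diameter_bounded_bound)
    moreover have "dist x y \<le> dist x' x + dist x' y' + dist y' y"
      using dist_triangle[of x y x'] dist_triangle[of x' y y'] by (simp add: dist_commute)
    ultimately show ?thesis using x' y' by (simp add: field_simps)
  qed
  have "S \<subseteq> (\<Union>i\<in>UNIV. V i)"
  proof
    fix x assume "x \<in> S"
    then obtain i where "x \<in> U i" using U(1) by blast
    moreover from this have "diameter (U i) < \<rho> i" using \<rho>(1) by blast
    ultimately show "x \<in> (\<Union>i\<in>UNIV. V i)" by (force simp: V_def)
  qed
  moreover have "open (V i)" for i by (auto simp: V_def)
  ultimately obtain I0 where I0: "finite I0" "S \<subseteq> (\<Union>i\<in>I0. V i)"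
    using compactE_image[OF assms(1), of UNIV V] by auto
  define I where "I = {i \<in> I0. U i \<noteq> {}}"
  have "U i \<noteq> {}" if "x \<in> V i" for x i using that by (auto simp: V_def)
  then have "(\<Union>i\<in>I0. V i) \<subseteq> (\<Union>i\<in>I. V i)" unfolding I_def by blast
  then have I: "finite I" "S \<subseteq> (\<Union>i\<in>I. V i)" using I0 by (auto simp: I_def)
  have "\<exists>T0. \<forall>T\<ge>T0. real (card {j \<in> X T. \<pi> T j \<in> V i}) \<le> C * \<rho> i powr s * real (card (X T))"
    if i: "i \<in> I" for i
  proof -
    obtain T0 where "\<forall>T\<ge>T0. \<forall>V. (\<forall>x\<in>V. \<forall>y\<in>V. dist x y \<le> \<rho> i) \<longrightarrow>
        real (card {j \<in> X T. \<pi> T j \<in> V}) \<le> C * \<rho> i powr s * real (card (X T))"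
      using mass[of "\<rho> i"] \<rho>(2)[of i] i by (auto simp: I_def)
    then show ?thesis using V_diam by blast
  qed
  then obtain T0 where T0: "\<And>i T. i \<in> I \<Longrightarrow> T \<ge> T0 i \<Longrightarrow>
      real (card {j \<in> X T. \<pi> T j \<in> V i}) \<le> C * \<rho> i powr s * real (card (X T))" by metis
  define T where "T = (\<Sum>i\<in>I. T0 i)"
  have T: "T0 i \<le> T" if "i \<in> I" for i using that I(1) by (auto simp: T_def intro: member_le_sum)
  have "card (X T) \<le> card (\<Union>i\<in>I. {j \<in> X T. \<pi> T j \<in> V i})"
    using subsetD[OF I(2) \<pi>] X(1) I(1) by (intro card_mono) auto
  also have "\<dots> \<le> (\<Sum>i\<in>I. card {j \<in> X T. \<pi> T j \<in> V i})" using I(1) by (rule card_UN_le)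
  finally have "card (X T) \<le> (\<Sum>i\<in>I. card {j \<in> X T. \<pi> T j \<in> V i})" .
  from of_nat_mono[OF this, where 'a = real]
  have "real (card (X T)) \<le> (\<Sum>i\<in>I. real (card {j \<in> X T. \<pi> T j \<in> V i}))" by simp
  also have "\<dots> \<le> (\<Sum>i\<in>I. C * \<rho> i powr s * real (card (X T)))"
    using T0 T by (intro sum_mono) auto
  also have "\<dots> = C * (\<Sum>i\<in>I. \<rho> i powr s) * real (card (X T))"
    by (simp add: sum_distrib_left sum_distrib_right mult.assoc)
  finally have one: "1 \<le> C * (\<Sum>i\<in>I. \<rho> i powr s)"
    using X[of T] by (simp add: card_gt_0_iff)
  have e_sum: "(\<Sum>i. ennreal (e i)) = ennreal (1 / (4 * C))"
  proof -
    have "e sums (1 / (4 * C) * 1)" unfolding e_def by (intro sums_mult power_half_series)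
    then show ?thesis using e by (intro suminf_ennreal_eq) (auto intro: less_imp_le)
  qed
  have "ennreal (\<Sum>i\<in>I. \<rho> i powr s) = (\<Sum>i\<in>I. ennreal (\<rho> i powr s))" by simp
  also have "\<dots> \<le> (\<Sum>i\<in>I. diam_pow s (U i) + ennreal (e i))"
    using \<rho>(3) by (intro sum_mono) (auto simp: I_def)
  also have "\<dots> \<le> (\<Sum>i. diam_pow s (U i) + ennreal (e i))"
    using I(1) by (intro sum_le_suminf) auto
  also have "\<dots> = (\<Sum>i. diam_pow s (U i)) + ennreal (1 / (4 * C))"
    using e_sum by (simp add: suminf_add[symmetric])
  also have "\<dots> \<le> ennreal (1 / (2 * C)) + ennreal (1 / (4 * C))"
    using sumU by (intro add_right_mono) auto
  also have "\<dots> = ennreal (3 / (4 * C))"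
    using C by (subst ennreal_plus[symmetric]) (auto simp: field_simps)
  finally have "(\<Sum>i\<in>I. \<rho> i powr s) \<le> 3 / (4 * C)"
    using C by (subst (asm) ennreal_le_iff) auto
  then have "C * (\<Sum>i\<in>I. \<rho> i powr s) \<le> C * (3 / (4 * C))" using C by (intro mult_left_mono) auto
  with one C show False by simp
qed

section \<open>Words\<close>

definition words :: "'a set \<Rightarrow> nat \<Rightarrow> 'a list set" where
  "words A n = {w. set w \<subseteq> A \<and> length w = n}"

lemma words_0 [simp]: "words A 0 = {[]}"
  by (auto simp: words_def)

lemma words_length: "w \<in> words A n \<Longrightarrow> length w = n"
  by (simp add: words_def)

lemma Cons_in_words [simp]: "i # w \<in> words A (Suc n) \<longleftrightarrow> i \<in> A \<and> w \<in> words A n"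
  by (auto simp: words_def)

lemma words_Suc: "words A (Suc n) = (\<lambda>(i, w). i # w) ` (A \<times> words A n)"
  by (auto simp: words_def length_Suc_conv)

lemma words_SucE:
  assumes "w \<in> words A (Suc n)"
  obtains i u where "w = i # u" "i \<in> A" "u \<in> words A n"
  using assms by (auto simp: words_Suc)

lemma append_in_words: "u \<in> words A m \<Longrightarrow> w \<in> words A n \<Longrightarrow> u @ w \<in> words A (m + n)"
  by (auto simp: words_def)

lemma take_in_words: "w \<in> words A n \<Longrightarrow> m \<le> n \<Longrightarrow> take m w \<in> words A m"
  by (auto simp: words_def dest: in_set_takeD)

lemma drop_in_words: "w \<in> words A n \<Longrightarrow> drop m w \<in> words A (n - m)"
  by (auto simp: words_def dest: in_set_dropD)

lemma concat_in_words: "W \<in> words (words A k) n \<Longrightarrow> concat W \<in> words A (k * n)"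
  by (induction n arbitrary: W) (auto elim!: words_SucE intro!: append_in_words)

lemma words_mono: "A \<subseteq> B \<Longrightarrow> words A n \<subseteq> words B n"
  by (auto simp: words_def)

lemma finite_words: "finite A \<Longrightarrow> finite (words A n)"
  by (simp add: words_def finite_lists_length_eq)

lemma card_words: "finite A \<Longrightarrow> card (words A n) = card A ^ n"
  by (simp add: words_def card_lists_length_eq)

lemma inj_concat_words: "inj_on concat (words (words A k) n)"
proof (rule inj_onI)
  fix V W assume "V \<in> words (words A k) n" "W \<in> words (words A k) n" "concat V = concat W"
  then show "V = W"
    by (intro concat_injective)
      (auto simp: words_def subset_iff elim!: in_set_zipE)
qed

lemma sum_words_prod_list:
  fixes g :: "'a \<Rightarrow> 'b::comm_semiring_1"
  assumes "finite A"
  shows "(\<Sum>w\<in>words A n. prod_list (map g w)) = (\<Sum>i\<in>A. g i) ^ n"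
proof (induction n)
  case (Suc n)
  have "(\<Sum>w\<in>words A (Suc n). prod_list (map g w))
      = (\<Sum>p\<in>A \<times> words A n. g (fst p) * prod_list (map g (snd p)))"
    unfolding words_Suc by (subst sum.reindex) (auto simp: inj_on_def intro!: sum.cong)
  also have "\<dots> = (\<Sum>i\<in>A. g i) * (\<Sum>w\<in>words A n. prod_list (map g w))"
    by (simp add: sum_product sum.cartesian_product split_def)
  finally show ?case by (simp add: Suc)
qed simp

abbreviation letters :: "nat set" where "letters \<equiv> {..<5}"

text \<open>The letter \<open>i\<close> stands for the map \<open>f\<close> with index \<open>i + 1\<close>. Over the column \<open>[1/3, 2/3]\<close> lie
  the three maps with letters \<open>1, 2, 3\<close>, over each outer column only one.\<close>

definition middle :: "nat \<Rightarrow> bool" where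
  "middle i \<longleftrightarrow> i \<in> {1, 2, 3}"

definition middle_count :: "nat list \<Rightarrow> nat" where
  "middle_count w = length (filter middle w)"

lemma middle_count_simps [simp]:
  "middle_count [] = 0"
  "middle_count (i # w) = (if middle i then 1 else 0) + middle_count w"
  "middle_count (u @ w) = middle_count u + middle_count w"
  by (auto simp: middle_count_def)

lemma middle_count_le: "middle_count w \<le> length w"
  by (simp add: middle_count_def)

lemma middle_count_concat: "(\<And>w. w \<in> set W \<Longrightarrow> middle_count w = j) \<Longrightarrow>
    middle_count (concat W) = j * length W"
  by (induction W) auto

lemma powr_middle_count:
  "3 powr (c * real (middle_count w)) = prod_list (map (\<lambda>i. if middle i then 3 powr c else 1) w)"
  by (induction w) (auto simp: powr_add distrib_left)

lemma letters_eq: "letters = {0, 1, 2, 3, 4}" by auto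

text \<open>The columns are named after letters that lie over them and do not reverse the horizontal
  direction. A word over \<open>columns\<close> can then be used as a word of maps as well.\<close>

abbreviation columns :: "nat set" where "columns \<equiv> {0, 1, 4}"

lemma columns_subset_letters: "columns \<subseteq> letters" by auto

text \<open>The three middle letters share the weight \<open>3 powr \<theta>\<close> of the middle column equally, so letters
  and columns have the same total weight \<open>2 + 3 powr \<theta>\<close>. Divided by it, these weights are McMullen's
  measure and its projection to the horizontal axis.\<close>

lemma sum_words_letters:
  "(\<Sum>w\<in>words letters n. 3 powr ((\<theta> - 1) * real (middle_count w))) = (2 + 3 powr \<theta>) ^ n"
proof -
  have "3 * 3 powr (\<theta> - 1) = 3 powr \<theta>" by (simp add: powr_diff)
  then show ?thesis unfolding powr_middle_count
    by (subst sum_words_prod_list) (simp_all add: letters_eq middle_def)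
qed

lemma sum_words_columns:
  "(\<Sum>w\<in>words columns n. 3 powr (\<theta> * real (middle_count w))) = (2 + 3 powr \<theta>) ^ n"
  unfolding powr_middle_count
  by (subst sum_words_prod_list) (simp_all add: middle_def)

section \<open>The horizontal action\<close>

definition hmap :: "nat \<Rightarrow> real \<Rightarrow> real" where
  "hmap i t = (if i = 0 then t else if i = 2 then 2 - t else if i = 4 then 2 + t else 1 + t) / 3"

fun hword :: "nat list \<Rightarrow> real \<Rightarrow> real" where
  "hword [] t = t"
| "hword (i # w) t = hmap i (hword w t)"

lemma hword_append: "hword (u @ w) t = hword u (hword w t)"
  by (induction u) auto

lemma abs_hmap_diff: "\<bar>hmap i s - hmap i t\<bar> = \<bar>s - t\<bar> / 3"
  by (simp add: hmap_def abs_if field_simps)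

lemma abs_hword_diff: "\<bar>hword w s - hword w t\<bar> = \<bar>s - t\<bar> / 3 ^ length w"
  by (induction w) (auto simp: abs_hmap_diff)

lemma hmap_inj: "hmap i s = hmap i t \<longleftrightarrow> s = t"
  using abs_hmap_diff[of i s t] by auto

lemma hword_inj: "hword w s = hword w t \<longleftrightarrow> s = t"
  using abs_hword_diff[of w s t] by auto

lemma hmap_in_unit: "0 \<le> t \<Longrightarrow> t \<le> 1 \<Longrightarrow> 0 \<le> hmap i t \<and> hmap i t \<le> 1"
  by (simp add: hmap_def)

lemma hword_in_unit: "0 \<le> t \<Longrightarrow> t \<le> 1 \<Longrightarrow> 0 \<le> hword w t \<and> hword w t \<le> 1"
  by (induction w) (auto simp: hmap_in_unit)

lemma hword_in_open_unit: "0 < t \<Longrightarrow> t < 1 \<Longrightarrow> 0 < hword w t \<and> hword w t < 1"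
  by (induction w) (auto simp: hmap_def)

text \<open>The horizontal projections of all cylinders of one level have the same width, so that they
  are determined by their midpoints, whether or not the words reverse the direction.\<close>

abbreviation midpoint :: "nat list \<Rightarrow> real" where
  "midpoint w \<equiv> hword w (1/2)"

lemma midpoint_lattice: "\<exists>z::int. 3 ^ length w * midpoint w = of_int z + 1/2"
proof (induction w)
  case Nil
  show ?case by (rule exI[of _ 0]) simp
next
  case (Cons i w)
  then obtain z :: int where z: "3 ^ length w * midpoint w = of_int z + 1/2" by blast
  consider "i = 0" | "i = 2" | "i = 4" | "i \<notin> {0, 2, 4}" by blast
  then show ?case
  proof cases
    case 1 then show ?thesis using z by (auto simp: hmap_def)
  next
    case 2 then show ?thesis using z
      by (intro exI[of _ "2 * 3 ^ length w - z - 1"]) (simp add: hmap_def field_simps)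
  next
    case 3 then show ?thesis using z
      by (intro exI[of _ "2 * 3 ^ length w + z"]) (simp add: hmap_def field_simps)
  next
    case 4 then show ?thesis using z
      by (intro exI[of _ "3 ^ length w + z"]) (simp add: hmap_def field_simps)
  qed
qed

text \<open>The midpoints of level \<open>n\<close> lie in the lattice of half-integers divided by \<open>3 ^ n\<close>, which has
  one element in each triadic interval.\<close>

lemma midpoint_eqI:
  assumes "length u = length w" and "\<lfloor>3 ^ length u * midpoint u\<rfloor> = \<lfloor>3 ^ length w * midpoint w\<rfloor>"
  shows "midpoint u = midpoint w"
proof -
  obtain y z :: int where y: "3 ^ length u * midpoint u = of_int y + 1/2"
    and z: "3 ^ length w * midpoint w = of_int z + 1/2" using midpoint_lattice by metis
  have "\<lfloor>of_int y + 1/2 :: real\<rfloor> = y" "\<lfloor>of_int z + 1/2 :: real\<rfloor> = z" by linarith+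
  then have "y = z" using assms(2) y z by simp
  then have "3 ^ length u * midpoint u = 3 ^ length u * midpoint w" using y z assms(1) by simp
  then show ?thesis by simp
qed

lemma hword_columns_inj:
  assumes "u \<in> words columns n" "w \<in> words columns n" "0 < s" "s < 1" "0 < t" "t < 1"
    and "hword u s = hword w t"
  shows "u = w"
  using assms
proof (induction n arbitrary: u w)
  case (Suc n)
  obtain i u' where u: "u = i # u'" "i \<in> columns" "u' \<in> words columns n"
    using Suc.prems(1) by (rule words_SucE)
  obtain j w' where w: "w = j # w'" "j \<in> columns" "w' \<in> words columns n"
    using Suc.prems(2) by (rule words_SucE)
  have "i = j"
    using Suc.prems(7) u w hword_in_open_unit[OF Suc.prems(3,4), of u']
      hword_in_open_unit[OF Suc.prems(5,6), of w']
    by (auto simp: hmap_def field_simps)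
  then show ?case using Suc u w by (auto simp: hmap_inj)
qed simp

text \<open>The word \<open>column_word w\<close> names the triadic interval onto which the cylinder of \<open>w\<close> projects
  (\<open>midpoint_column_word\<close>). The reversing letter \<open>2\<close> exchanges left and right in everything
  that follows it. Since both outer columns carry one map, this leaves the number of middle letters
  unchanged.\<close>

definition flip_column :: "nat \<Rightarrow> nat" where
  "flip_column i = (if i = 0 then 4 else if i = 4 then 0 else i)"

fun column_word :: "nat list \<Rightarrow> nat list" where
  "column_word [] = []"
| "column_word (i # w) = (if middle i then 1 else i) #
     (if i = 2 then map flip_column (column_word w) else column_word w)"

lemma flip_column_flip_column [simp]: "flip_column (flip_column i) = i"
  by (simp add: flip_column_def)

lemma map_flip_column_eq_iff: "map flip_column u = v \<longleftrightarrow> u = map flip_column v"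
  by (auto simp: comp_def)

lemma flip_columns: "u \<in> words columns n \<Longrightarrow> map flip_column u \<in> words columns n"
  by (auto simp: words_def flip_column_def)

lemma middle_flip_column [simp]: "middle (flip_column i) = middle i"
  by (auto simp: middle_def flip_column_def)

lemma middle_count_flip [simp]: "middle_count (map flip_column u) = middle_count u"
  by (induction u) auto

lemma hword_flip: "set u \<subseteq> columns \<Longrightarrow> hword (map flip_column u) (1 - t) = 1 - hword u t"
  by (induction u) (auto simp: flip_column_def hmap_def field_simps)

lemma column_word_in_words: "w \<in> words letters n \<Longrightarrow> column_word w \<in> words columns n"
proof (induction n arbitrary: w)
  case (Suc n)
  then obtain i u where w: "w = i # u" "i \<in> letters" "u \<in> words letters n" by (elim words_SucE)
  then show ?case using Suc.IH[of u] flip_columns[of "column_word u" n]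
    by (auto simp: middle_def letters_eq)
qed simp

lemma middle_count_column_word [simp]: "middle_count (column_word w) = middle_count w"
  by (induction w) (auto simp: middle_def)

lemma midpoint_column_word: "w \<in> words letters n \<Longrightarrow> midpoint (column_word w) = midpoint w"
proof (induction n arbitrary: w)
  case (Suc n)
  then obtain i u where w: "w = i # u" "i \<in> letters" "u \<in> words letters n" by (elim words_SucE)
  have "set (column_word u) \<subseteq> columns"
    using column_word_in_words[OF w(3)] by (simp add: words_def)
  then have "midpoint (map flip_column (column_word u)) = 1 - midpoint (column_word u)"
    using hword_flip[of "column_word u" "1/2"] by simp
  then show ?case using Suc.IH[OF w(3)] w(1,2) by (auto simp: hmap_def middle_def letters_eq)
qed simp

text \<open>Each middle symbol of \<open>v\<close> comes from three letters; the letter \<open>2\<close> among them continues with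
  words over the reversed remainder of \<open>v\<close>, which has as many middle symbols.\<close>

lemma card_column_word_fibre:
  assumes "v \<in> words columns n"
  shows "card {w \<in> words letters n. column_word w = v} \<le> 3 ^ middle_count v"
  using assms
proof (induction n arbitrary: v)
  case 0
  then show ?case by (simp add: card_le_Suc0_iff_eq)
next
  case (Suc n)
  then obtain c u where v: "v = c # u" "c \<in> columns" "u \<in> words columns n" by (elim words_SucE)
  define F where "F u = {w \<in> words letters n. column_word w = u}" for u
  have fin: "finite (F u)" for u by (simp add: F_def finite_words)
  have F: "card (F u) \<le> 3 ^ middle_count u" "card (F (map flip_column u)) \<le> 3 ^ middle_count u"
    using Suc.IH[OF v(3)] Suc.IH[OF flip_columns[OF v(3)]] by (simp_all add: F_def)
  show ?case
  proof (cases "c = 1")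
    case True
    have "{w \<in> words letters (Suc n). column_word w = v}
       \<subseteq> (#) 1 ` F u \<union> (#) 2 ` F (map flip_column u) \<union> (#) 3 ` F u"
      using True v by (auto simp: F_def letters_eq middle_def map_flip_column_eq_iff elim!: words_SucE)
    then have "card {w \<in> words letters (Suc n). column_word w = v}
       \<le> card ((#) 1 ` F u \<union> (#) 2 ` F (map flip_column u) \<union> (#) 3 ` F u)"
      using fin by (intro card_mono) auto
    also have "\<dots> \<le> card (F u) + card (F (map flip_column u)) + card (F u)"
      by (intro order_trans[OF card_Un_le] add_mono card_image_le fin)
    also have "\<dots> \<le> 3 ^ middle_count v" using F v True by (simp add: middle_def)
    finally show ?thesis .
  next
    case False
    have "{w \<in> words letters (Suc n). column_word w = v} \<subseteq> (#) c ` F u"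
      using False v by (auto simp: F_def letters_eq middle_def elim!: words_SucE split: if_splits)
    then have "card {w \<in> words letters (Suc n). column_word w = v} \<le> card ((#) c ` F u)"
      using fin by (intro card_mono) auto
    also have "\<dots> \<le> card (F u)" by (rule card_image_le[OF fin])
    also have "\<dots> \<le> 3 ^ middle_count v" using F v False by (auto simp: middle_def)
    finally show ?thesis .
  qed
qed

lemma UN_words_Suc: "(\<Union>w\<in>words A (Suc n). f w) = (\<Union>i\<in>A. \<Union>w\<in>words A n. f (i # w))"
  by (auto simp: words_Suc)

section \<open>The planar maps and their attractor\<close>

definition shear :: "real \<Rightarrow> nat \<Rightarrow> real" where
  "shear a i = (if i = 2 then 0 else d_par a)"

text \<open>The lower edge of the horizontal strip that contains the image of the unit square under the
  map \<open>i\<close>. The strip of the unsheared map \<open>2\<close> has height \<open>a\<close>, the others have height \<open>a + d\<close>;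
  this is the reason for the case distinction, and \<open>base a 5\<close> is the upper edge of the last strip.\<close>

definition base :: "real \<Rightarrow> nat \<Rightarrow> real" where
  "base a i = (if i \<le> 2 then real i * (a + d_par a) else real i * a + (real i - 1) * d_par a)"

definition zmap :: "real \<Rightarrow> nat \<Rightarrow> real^2 \<Rightarrow> real^2" where
  "zmap a i p = vector [hmap i (p$1), shear a i * p$1 + a * p$2 + base a i]"

fun zword :: "real \<Rightarrow> nat list \<Rightarrow> real^2 \<Rightarrow> real^2" where
  "zword a [] p = p"
| "zword a (i # w) p = zmap a i (zword a w p)"

lemma zmap_1 [simp]: "zmap a i p $ 1 = hmap i (p$1)"
  and zmap_2 [simp]: "zmap a i p $ 2 = shear a i * p$1 + a * p$2 + base a i"
  by (simp_all add: zmap_def)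

lemma vec2_eqI: "p$1 = q$1 \<Longrightarrow> p$2 = q$2 \<Longrightarrow> p = (q :: real^2)"
  by (simp add: vec_eq_iff forall_2)

lemma ifs_eq: "ifs a = zmap a ` letters"
proof -
  have "(\<lambda>x. A_mat a *v x) = zmap a 0"
    "(\<lambda>x. A_mat a *v x + vector [1/3, a + d_par a]) = zmap a 1"
    "(\<lambda>x. A_minus_mat a *v x + vector [2/3, 2 * (a + d_par a)]) = zmap a 2"
    "(\<lambda>x. A_mat a *v x + vector [1/3, 3 * a + 2 * d_par a]) = zmap a 3"
    "(\<lambda>x. A_mat a *v x + vector [2/3, 4 * a + 3 * d_par a]) = zmap a 4"
    by (intro ext vec2_eqI;
        simp add: A_mat_def A_minus_mat_def matrix_vector_mult_def sum_2 hmap_def shear_def base_def field_simps)+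
  then show ?thesis unfolding ifs_def Let_def letters_eq by simp
qed

lemma zword_append: "zword a (u @ w) p = zword a u (zword a w p)"
  by (induction u) auto

lemma zword_1 [simp]: "zword a w p $ 1 = hword w (p$1)"
  by (induction w) auto

lemma zword_2_same_1:
  "p$1 = q$1 \<Longrightarrow> zword a w p $ 2 - zword a w q $ 2 = a ^ length w * (p$2 - q$2)"
proof (induction w)
  case (Cons i w)
  then have "zword a (i # w) p $ 2 - zword a (i # w) q $ 2 = a * (zword a w p $ 2 - zword a w q $ 2)"
    by (simp add: algebra_simps)
  then show ?case using Cons by simp
qed simp

abbreviation unit_square :: "(real^2) set" where
  "unit_square \<equiv> cbox 0 1"

lemma in_unit_square: "p \<in> unit_square \<longleftrightarrow> 0 \<le> p$1 \<and> p$1 \<le> 1 \<and> 0 \<le> p$2 \<and> p$2 \<le> 1"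
  by (auto simp: mem_box_cart forall_2)

lemma dist_le_coordinates: "dist p q \<le> \<bar>p$1 - q$1\<bar> + \<bar>p$2 - (q :: real^2)$2\<bar>"
  unfolding dist_vec_def using L2_set_le_sum_abs[of "\<lambda>i. dist (p$i) (q$i)" UNIV]
  by (simp add: sum_2 dist_real_def)

lemma coordinate_le_dist: "\<bar>p$i - q$i\<bar> \<le> dist p (q :: real^2)"
  using dist_vec_nth_le[of p i q] by (simp add: dist_real_def)

locale zipper =
  fixes a :: real
  assumes a_pos: "0 < a" and a_le: "a \<le> 1/5"
begin

lemma d_bounds: "0 \<le> d_par a" "d_par a + a \<le> 1/4"
  using a_pos a_le by (simp_all add: d_par_def diff_divide_distrib)

lemma shear_bounds: "0 \<le> shear a i" "shear a i \<le> d_par a"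
  using d_bounds by (auto simp: shear_def)

lemma base_mono: "i \<le> j \<Longrightarrow> base a i \<le> base a j"
proof (rule lift_Suc_mono_le[of "base a"])
  show "base a n \<le> base a (Suc n)" for n
    using d_bounds a_pos by (cases "n = 2") (auto simp: base_def algebra_simps)
qed

lemma base_0: "base a 0 = 0" and base_5: "base a 5 = 1"
  by (simp_all add: base_def d_par_def diff_divide_distrib)

text \<open>Words with different first letters put their cylinders into different strips. This is the
  source of all separation between cylinders.\<close>

lemma zmap_strip:
  assumes "p \<in> unit_square" "i \<in> letters"
  shows "base a i \<le> zmap a i p $ 2" "zmap a i p $ 2 \<le> base a (Suc i)"
proof -
  have p: "0 \<le> p$1" "p$1 \<le> 1" "0 \<le> p$2" "p$2 \<le> 1" using assms by (auto simp: in_unit_square)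
  have "0 \<le> shear a i * p$1" "0 \<le> a * p$2" using p shear_bounds a_pos by auto
  then show "base a i \<le> zmap a i p $ 2" by simp
  have "shear a i * p$1 \<le> shear a i" "a * p$2 \<le> a"
    using p shear_bounds a_pos by (auto intro: mult_left_le)
  moreover have "shear a i + a + base a i = base a (Suc i)"
    using assms(2) by (auto simp: letters_eq shear_def base_def algebra_simps)
  ultimately show "zmap a i p $ 2 \<le> base a (Suc i)" by simp
qed

lemma zmap_unit_square:
  assumes "p \<in> unit_square" "i \<in> letters"
  shows "zmap a i p \<in> unit_square"
proof -
  have "0 \<le> base a i" "base a (Suc i) \<le> 1"
    using base_mono[of 0 i] base_mono[of "Suc i" 5] assms(2) by (auto simp: base_0 base_5)
  then show ?thesis
    using zmap_strip[OF assms] hmap_in_unit[of "p$1" i] assms(1) unfolding in_unit_square by auto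
qed

lemma zword_unit_square: "p \<in> unit_square \<Longrightarrow> w \<in> words letters n \<Longrightarrow> zword a w p \<in> unit_square"
  by (induction n arbitrary: w) (auto elim!: words_SucE simp: zmap_unit_square)

text \<open>One more map turns a vertical variation \<open>x / 3 ^ n\<close> along a horizontal segment into at most
  \<open>(d + a) * x / 3 ^ n\<close>, and \<open>d + a \<le> 1/3\<close>. So the tilt of a cylinder never exceeds its width.\<close>

lemma zword_2_diff:
  "\<bar>zword a w p $ 2 - zword a w q $ 2\<bar> \<le> \<bar>p$1 - q$1\<bar> / 3 ^ length w + a ^ length w * \<bar>p$2 - q$2\<bar>"
proof (induction w)
  case (Cons i w)
  let ?X = "\<bar>p$1 - q$1\<bar> / 3 ^ length w" and ?Y = "a ^ length w * \<bar>p$2 - q$2\<bar>"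
  have "zword a (i # w) p $ 2 - zword a (i # w) q $ 2 =
      shear a i * (zword a w p $ 1 - zword a w q $ 1) + a * (zword a w p $ 2 - zword a w q $ 2)"
    by (simp add: algebra_simps)
  then have "\<bar>zword a (i # w) p $ 2 - zword a (i # w) q $ 2\<bar> \<le>
      shear a i * \<bar>hword w (p$1) - hword w (q$1)\<bar> + a * \<bar>zword a w p $ 2 - zword a w q $ 2\<bar>"
    using abs_triangle_ineq shear_bounds a_pos by (metis abs_mult abs_of_nonneg less_imp_le zword_1)
  also have "\<dots> \<le> d_par a * ?X + a * (?X + ?Y)"
    using Cons shear_bounds a_pos d_bounds
    by (intro add_mono mult_mono) (auto simp: abs_hword_diff)
  also have "\<dots> = (d_par a + a) * ?X + a * ?Y" by (simp only: distrib_left distrib_right add.assoc)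
  also have "\<dots> \<le> 1/3 * ?X + a * ?Y"
    using d_bounds by (intro add_right_mono mult_right_mono) auto
  finally show ?case by (simp add: mult.assoc)
qed simp

lemma a_power_le: "a ^ n \<le> (1/3) ^ n"
  using a_pos a_le by (intro power_mono) auto

lemma zword_dist: "dist (zword a w p) (zword a w q) \<le> 4 * dist p q * (1/3) ^ length w"
proof -
  let ?n = "length w"
  have "dist (zword a w p) (zword a w q) \<le>
     \<bar>p$1 - q$1\<bar> / 3 ^ ?n + (\<bar>p$1 - q$1\<bar> / 3 ^ ?n + a ^ ?n * \<bar>p$2 - q$2\<bar>)"
    using dist_le_coordinates[of "zword a w p" "zword a w q"] zword_2_diff[of w p q]
    by (simp add: abs_hword_diff)
  also have "\<dots> \<le> dist p q / 3 ^ ?n + (dist p q / 3 ^ ?n + (1/3) ^ ?n * dist p q)"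
    using a_power_le[of ?n] coordinate_le_dist
    by (intro add_mono divide_right_mono mult_mono) auto
  also have "\<dots> \<le> 4 * dist p q * (1/3) ^ ?n" by (simp add: field_simps)
  finally show ?thesis .
qed

lemma zmap_inj: "zmap a i p = zmap a i q \<longleftrightarrow> p = q"
proof
  assume "zmap a i p = zmap a i q"
  then have eq: "zmap a i p $ 1 = zmap a i q $ 1" "zmap a i p $ 2 = zmap a i q $ 2" by auto
  then show "p = q" using a_pos by (intro vec2_eqI) (auto simp: hmap_inj)
qed simp

lemma continuous_on_zmap: "continuous_on S (zmap a i)"
proof (rule lipschitz_on_continuous_on)
  show "(4/3)-lipschitz_on S (zmap a i)"
    using zword_dist[of "[i]"] by (intro lipschitz_onI) auto
qed

lemma invariant_unfold:
  assumes "S = (\<Union>i\<in>letters. zmap a i ` S)"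
  shows "S = (\<Union>w\<in>words letters n. zword a w ` S)"
proof (induction n)
  case (Suc n)
  note assms
  also have "(\<Union>i\<in>letters. zmap a i ` S)
      = (\<Union>i\<in>letters. zmap a i ` (\<Union>w\<in>words letters n. zword a w ` S))"
    by (rule arg_cong[OF Suc])
  also have "\<dots> = (\<Union>w\<in>words letters (Suc n). zword a w ` S)"
    by (simp add: UN_words_Suc image_UN image_image)
  finally show ?case .
qed simp

text \<open>Every point of \<open>S\<close> is the image of a point of \<open>S\<close> under a word of length \<open>n\<close>. The same word
  moves a point of \<open>T\<close> to within a constant times \<open>3 ^ (- n)\<close> of it.\<close>

lemma invariant_subset:
  assumes S: "S = (\<Union>i\<in>letters. zmap a i ` S)" "compact S"
    and T: "T = (\<Union>i\<in>letters. zmap a i ` T)" "compact T" "T \<noteq> {}"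
  shows "S \<subseteq> T"
proof
  fix x assume x: "x \<in> S"
  obtain q where q: "q \<in> T" using T(3) by blast
  have "bounded S" using S(2) by (rule compact_imp_bounded)
  then obtain B where B: "\<And>y. y \<in> S \<Longrightarrow> dist y q \<le> B"
    unfolding bounded_any_center[of S q] dist_commute[of q] by blast
  have "\<exists>y\<in>T. dist y x < e" if "e > 0" for e
  proof -
    have "(\<lambda>n. 4 * B * (1/3) ^ n) \<longlonglongrightarrow> 0" by real_asymp
    then have "eventually (\<lambda>n. 4 * B * (1/3) ^ n < e) sequentially" using that by (rule order_tendstoD)
    then obtain n where n: "4 * B * (1/3) ^ n < e" by (auto simp: eventually_sequentially)
    obtain w y where w: "w \<in> words letters n" "y \<in> S" "x = zword a w y"
      using x invariant_unfold[OF S(1), of n] by blast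
    have "zword a w q \<in> T" using invariant_unfold[OF T(1), of n] q w(1) by blast
    moreover have "dist x (zword a w q) \<le> 4 * dist y q * (1/3) ^ n"
      using zword_dist[of w y q] w by (simp add: words_length)
    moreover have "4 * dist y q * (1/3) ^ n \<le> 4 * B * (1/3) ^ n" using B[OF w(2)] by simp
    ultimately show ?thesis using n
      by (intro bexI[of _ "zword a w q"]) (simp_all only: dist_commute[of _ x] order.strict_trans1)
  qed
  then have "x \<in> closure T" by (simp add: closure_approachable)
  then show "x \<in> T" using T(2) by (simp add: compact_imp_closed)
qed

definition level_set :: "nat \<Rightarrow> (real^2) set" where
  "level_set n = (\<Union>w\<in>words letters n. zword a w ` unit_square)"

lemma level_set_0 [simp]: "level_set 0 = unit_square"
  by (simp add: level_set_def)

lemma level_set_Suc: "level_set (Suc n) = (\<Union>i\<in>letters. zmap a i ` level_set n)"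
  by (simp add: level_set_def UN_words_Suc image_UN image_image)

lemma level_set_decreasing: "m \<le> n \<Longrightarrow> level_set n \<subseteq> level_set m"
proof -
  have "level_set (Suc n) \<subseteq> level_set n" for n
  proof (induction n)
    case 0
    show ?case by (auto simp: level_set_Suc zmap_unit_square simp del: mem_box)
  next
    case (Suc n)
    then show ?case unfolding level_set_Suc[of n] level_set_Suc[of "Suc n"] by blast
  qed
  then show "m \<le> n \<Longrightarrow> level_set n \<subseteq> level_set m" by (rule lift_Suc_antimono_le)
qed

lemma compact_level_set: "compact (level_set n)"
proof (induction n)
  case (Suc n)
  then show ?case unfolding level_set_Suc
    by (intro compact_UN compact_continuous_image continuous_on_zmap) auto
qed (simp add: compact_cbox)

text \<open>The decreasing intersection provides the existence of the attractor; uniqueness is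
  \<open>invariant_subset\<close>.\<close>

definition limit_set :: "(real^2) set" where
  "limit_set = (\<Inter>n. level_set n)"

lemma limit_set_invariant: "limit_set = (\<Union>i\<in>letters. zmap a i ` limit_set)"
proof (intro equalityI subsetI)
  fix p assume p: "p \<in> (\<Union>i\<in>letters. zmap a i ` limit_set)"
  have "p \<in> level_set n" for n
  proof -
    have "p \<in> level_set (Suc n)" using p unfolding level_set_Suc limit_set_def by blast
    then show ?thesis using level_set_decreasing[of n "Suc n"] by auto
  qed
  then show "p \<in> limit_set" by (simp add: limit_set_def)
next
  fix p assume p: "p \<in> limit_set"
  have "p \<in> level_set (Suc n)" for n using p by (simp add: limit_set_def)
  then have "\<forall>n. \<exists>i. i \<in> letters \<and> p \<in> zmap a i ` level_set n"
    unfolding level_set_Suc by blast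
  then obtain c where c: "\<And>n. c n \<in> letters" "\<And>n. p \<in> zmap a (c n) ` level_set n" by metis
  \<comment> \<open>Some letter works for infinitely many levels, hence for all of them.\<close>
  have "finite (range c)" using c(1) by (intro finite_subset[of "range c" letters] image_subsetI finite_lessThan)
  then obtain n0 where inf: "infinite {n. c n = c n0}"
    using pigeonhole_infinite[of UNIV c] by auto
  have all: "p \<in> zmap a (c n0) ` level_set n" for n
  proof -
    obtain m where m: "m > n" "c m = c n0" using inf by (auto simp: infinite_nat_iff_unbounded)
    then show ?thesis using c(2)[of m] level_set_decreasing[of n m] by auto
  qed
  from all[of 0] obtain q where q: "p = zmap a (c n0) q" by blast
  have "q \<in> level_set n" for n using all[of n] q by (auto simp: zmap_inj)
  then have "q \<in> limit_set" by (simp add: limit_set_def)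
  then show "p \<in> (\<Union>i\<in>letters. zmap a i ` limit_set)" using q c(1) by blast
qed

lemma zero_in_limit_set: "0 \<in> limit_set"
proof -
  have z: "zmap a 0 0 = 0" by (rule vec2_eqI) (simp_all add: hmap_def base_0)
  have "0 \<in> level_set n" for n
  proof (induction n)
    case (Suc n)
    then have "zmap a 0 0 \<in> level_set (Suc n)"
      unfolding level_set_Suc by (intro UN_I[of 0] imageI) auto
    then show ?case by (simp only: z)
  qed (simp add: in_unit_square)
  then show ?thesis by (simp add: limit_set_def)
qed

lemma compact_limit_set: "compact limit_set"
  unfolding limit_set_def using compact_level_set by (intro compact_Inter) auto

lemma Lambda_eq_limit_set: "Lambda a = limit_set"
proof -
  have "(THE S. S \<noteq> {} \<and> compact S \<and> S = (\<Union>i\<in>letters. zmap a i ` S)) = limit_set"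
  proof (rule the_equality)
    show "limit_set \<noteq> {} \<and> compact limit_set \<and> limit_set = (\<Union>i\<in>letters. zmap a i ` limit_set)"
      using zero_in_limit_set compact_limit_set limit_set_invariant by blast
    fix S assume S: "S \<noteq> {} \<and> compact S \<and> S = (\<Union>i\<in>letters. zmap a i ` S)"
    then show "S = limit_set"
      using invariant_subset[of S limit_set] invariant_subset[of limit_set S]
        zero_in_limit_set compact_limit_set limit_set_invariant by blast
  qed
  then show ?thesis by (simp add: Lambda_def attractor_def ifs_eq)
qed

lemma Lambda_unit_square: "Lambda a \<subseteq> unit_square"
  unfolding Lambda_eq_limit_set limit_set_def using level_set_0 by blast

lemma compact_Lambda: "compact (Lambda a)"
  by (simp add: Lambda_eq_limit_set compact_limit_set)

lemma zero_in_Lambda: "0 \<in> Lambda a"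
  by (simp add: Lambda_eq_limit_set zero_in_limit_set)

lemma Lambda_unfold: "Lambda a = (\<Union>w\<in>words letters n. zword a w ` Lambda a)"
  unfolding Lambda_eq_limit_set by (rule invariant_unfold[OF limit_set_invariant])

lemma zword_in_Lambda: "w \<in> words letters n \<Longrightarrow> p \<in> Lambda a \<Longrightarrow> zword a w p \<in> Lambda a"
  using Lambda_unfold[of n] by blast

lemma Lambda_coding:
  assumes "p \<in> Lambda a"
  obtains \<omega> where "\<And>n. \<omega> n \<in> letters" "\<And>n. \<exists>q\<in>Lambda a. p = zword a (map \<omega> [0..<n]) q"
proof -
  have "\<forall>q\<in>Lambda a. \<exists>i r. i \<in> letters \<and> r \<in> Lambda a \<and> q = zmap a i r"
    using limit_set_invariant unfolding Lambda_eq_limit_set by blast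
  then obtain \<iota> \<tau> where step: "\<And>q. q \<in> Lambda a \<Longrightarrow> \<iota> q \<in> letters \<and> \<tau> q \<in> Lambda a \<and> q = zmap a (\<iota> q) (\<tau> q)"
    by metis
  have orbit: "(\<tau> ^^ n) p \<in> Lambda a" for n
    by (induction n) (use assms step in auto)
  define \<omega> where "\<omega> n = \<iota> ((\<tau> ^^ n) p)" for n
  have "p = zword a (map \<omega> [0..<n]) ((\<tau> ^^ n) p)" for n
  proof (induction n)
    case (Suc n)
    then show ?case using step[OF orbit[of n]] by (simp add: zword_append \<omega>_def)
  qed simp
  then show ?thesis using orbit step by (intro that[of \<omega>]) (auto simp: \<omega>_def)
qed

end

lemma card_le_sum_fibres:
  fixes f :: "'a \<Rightarrow> 'b"
  assumes "finite P" and "f ` S \<subseteq> P" and "\<And>b. b \<in> P \<Longrightarrow> card {x \<in> S. f x = b} \<le> c" and "finite S"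
  shows "card S \<le> card P * c"
proof -
  have "S = (\<Union>b\<in>P. {x \<in> S. f x = b})" using assms(2) by blast
  then have "card S \<le> (\<Sum>b\<in>P. card {x \<in> S. f x = b})" using card_UN_le[OF assms(1)] by metis
  also have "\<dots> \<le> (\<Sum>b\<in>P. c)" using assms(3) by (rule sum_mono)
  finally show ?thesis by simp
qed

section \<open>Approximate squares\<close>

context zipper
begin

text \<open>The approximate squares: the part of the cylinder of \<open>w\<close> over the triadic interval that the
  column word \<open>v\<close> cuts out of it. Its width is \<open>3 ^ (- (length w + length v))\<close> and its vertical
  sections have length \<open>a ^ length w\<close>.\<close>

definition block :: "nat list \<Rightarrow> nat list \<Rightarrow> (real^2) set" where
  "block w v = zword a w ` {p \<in> unit_square. \<bar>p$1 - midpoint v\<bar> \<le> 1 / 3 ^ length v / 2}"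

definition centre :: "nat list \<Rightarrow> nat list \<Rightarrow> real^2" where
  "centre w v = zword a w (vector [midpoint v, 0])"

lemma zword_in_block:
  assumes "p \<in> unit_square" "u \<in> words letters l"
  shows "zword a (w @ u) p \<in> block w (column_word u)"
proof -
  have len: "length (column_word u) = l" "length u = l"
    using column_word_in_words[OF assms(2)] assms(2) by (auto dest: words_length)
  have "\<bar>p$1 - 1/2\<bar> \<le> 1/2" using assms(1) unfolding in_unit_square by (auto simp: abs_if)
  then have "\<bar>hword u (p$1) - midpoint u\<bar> \<le> 1 / 3 ^ l / 2"
    by (simp add: abs_hword_diff len field_simps)
  then show ?thesis
    using zword_unit_square[OF assms] midpoint_column_word[OF assms(2)] len
    unfolding block_def zword_append by (intro imageI) (simp del: mem_box)
qed

lemma block_near_centre: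
  assumes "p \<in> block w v"
  shows "\<bar>p$1 - centre w v $ 1\<bar> \<le> 1 / 3 ^ (length w + length v) / 2"
    and "\<bar>p$2 - centre w v $ 2\<bar> \<le> 1 / 3 ^ (length w + length v) / 2 + a ^ length w"
proof -
  obtain q where q: "q \<in> unit_square" "\<bar>q$1 - midpoint v\<bar> \<le> 1 / 3 ^ length v / 2" "p = zword a w q"
    using assms by (auto simp: block_def simp del: mem_box)
  let ?c = "vector [midpoint v, 0] :: real^2"
  have 1: "\<bar>q$1 - ?c$1\<bar> / 3 ^ length w \<le> (1 / 3 ^ length v / 2) / 3 ^ length w"
    using q by (intro divide_right_mono) auto
  then show "\<bar>p$1 - centre w v $ 1\<bar> \<le> 1 / 3 ^ (length w + length v) / 2"
    by (simp add: q centre_def abs_hword_diff power_add mult_ac)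
  have "a ^ length w * \<bar>q$2 - ?c$2\<bar> \<le> a ^ length w"
    using q(1) a_pos unfolding in_unit_square by (intro mult_left_le) auto
  then show "\<bar>p$2 - centre w v $ 2\<bar> \<le> 1 / 3 ^ (length w + length v) / 2 + a ^ length w"
    using zword_2_diff[of w q ?c] 1 by (simp add: q centre_def power_add mult_ac)
qed

lemma block_dist:
  assumes "p \<in> block w v" "q \<in> block w v"
  shows "dist p q \<le> 2 / 3 ^ (length w + length v) + a ^ length w"
proof -
  obtain x y where x: "x \<in> unit_square" "\<bar>x$1 - midpoint v\<bar> \<le> 1 / 3 ^ length v / 2" "p = zword a w x"
    and y: "y \<in> unit_square" "\<bar>y$1 - midpoint v\<bar> \<le> 1 / 3 ^ length v / 2" "q = zword a w y"
    using assms by (auto simp: block_def simp del: mem_box)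
  have "\<bar>x$1 - y$1\<bar> \<le> 1 / 3 ^ length v / 2 + 1 / 3 ^ length v / 2"
    using x(2) y(2) unfolding abs_le_iff by linarith
  then have "\<bar>x$1 - y$1\<bar> \<le> 1 / 3 ^ length v" by simp
  then have 1: "\<bar>x$1 - y$1\<bar> / 3 ^ length w \<le> 1 / 3 ^ (length w + length v)"
    by (simp add: power_add field_simps)
  have "a ^ length w * \<bar>x$2 - y$2\<bar> \<le> a ^ length w"
    using x(1) y(1) a_pos unfolding in_unit_square by (intro mult_left_le) auto
  then show ?thesis
    using zword_2_diff[of w x y] dist_le_coordinates[of p q] 1 by (simp add: x(3) y(3) abs_hword_diff)
qed

text \<open>On a vertical line, cylinders of level \<open>n\<close> are segments of length \<open>a ^ n\<close>. At the first
  letter where two words differ they are put into different strips, so the segments do not overlap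
  and their lower end points are at least their length apart.\<close>

lemma vertical_separation:
  assumes "w \<in> words letters n" "u \<in> words letters n" "w \<noteq> u"
    and "p \<in> unit_square" "q \<in> unit_square" "p$2 = 0" "q$2 = 0"
    and "hword w (p$1) = hword u (q$1)"
  shows "a ^ n \<le> \<bar>zword a w p $ 2 - zword a u q $ 2\<bar>"
  using assms
proof (induction n arbitrary: w u)
  case (Suc n)
  obtain i w' where w: "w = i # w'" "i \<in> letters" "w' \<in> words letters n"
    using Suc.prems(1) by (rule words_SucE)
  obtain j u' where u: "u = j # u'" "j \<in> letters" "u' \<in> words letters n"
    using Suc.prems(2) by (rule words_SucE)
  \<comment> \<open>The vertical segment above \<open>r\<close> lies in the strip of the first letter.\<close>
  have strip: "base a k \<le> zword a (k # x) r $ 2"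
      "zword a (k # x) r $ 2 + a ^ Suc n \<le> base a (Suc k)"
    if "k \<in> letters" "x \<in> words letters n" "r \<in> unit_square" "r$2 = 0" for k x and r :: "real^2"
  proof -
    define r' :: "real^2" where "r' = vector [r$1, 1]"
    have r': "r' \<in> unit_square" using that(3) unfolding in_unit_square r'_def by simp
    have "zword a (k # x) r' $ 2 - zword a (k # x) r $ 2 = a ^ Suc n"
      using zword_2_same_1[of r' r a "k # x"] that by (simp add: r'_def words_length)
    moreover have "zword a (k # x) r' $ 2 \<le> base a (Suc k)"
      using zmap_strip(2)[OF zword_unit_square[OF r' that(2)] that(1)] by simp
    ultimately show "zword a (k # x) r $ 2 + a ^ Suc n \<le> base a (Suc k)" by linarith
    show "base a k \<le> zword a (k # x) r $ 2"
      using zmap_strip(1)[OF zword_unit_square[OF that(3,2)] that(1)] by simp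
  qed
  show ?case
  proof (cases "i = j")
    case True
    then have eq: "hword w' (p$1) = hword u' (q$1)" using Suc.prems(8) w u by (simp add: hmap_inj)
    then have "a ^ n \<le> \<bar>zword a w' p $ 2 - zword a u' q $ 2\<bar>"
      using Suc True w u by auto
    then have "a * a ^ n \<le> a * \<bar>zword a w' p $ 2 - zword a u' q $ 2\<bar>" using a_pos by simp
    also have "\<dots> = \<bar>a * (zword a w' p $ 2 - zword a u' q $ 2)\<bar>" using a_pos by (simp add: abs_mult)
    also have "\<dots> = \<bar>zword a w p $ 2 - zword a u q $ 2\<bar>"
      using eq by (simp add: w u True algebra_simps)
    finally show ?thesis by simp
  next
    case False
    then consider "i < j" | "j < i" by linarith
    then show ?thesis
    proof cases
      case 1
      then have "base a (Suc i) \<le> base a j" by (intro base_mono) simp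
      then show ?thesis
        using strip[OF w(2,3) Suc.prems(4,6)] strip[OF u(2,3) Suc.prems(5,7)] unfolding w u by linarith
    next
      case 2
      then have "base a (Suc j) \<le> base a i" by (intro base_mono) simp
      then show ?thesis
        using strip[OF w(2,3) Suc.prems(4,6)] strip[OF u(2,3) Suc.prems(5,7)] unfolding w u by linarith
    qed
  qed
qed simp

text \<open>The centres of the approximate squares lie in different cells of a grid with mesh
  \<open>3 ^ (- (n + l))\<close> horizontally and \<open>a ^ n\<close> vertically. In one column the words \<open>w\<close> differ, and
  \<open>vertical_separation\<close> applies on the vertical line through the middle of the column.\<close>

lemma centre_floor_inj:
  "inj_on (\<lambda>(w, v). (\<lfloor>3 ^ (n + l) * centre w v $ 1\<rfloor>, \<lfloor>centre w v $ 2 / a ^ n\<rfloor>))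
     (words letters n \<times> words columns l)"
proof (rule inj_onI, clarify)
  fix w v w' v'
  assume w: "w \<in> words letters n" "w' \<in> words letters n"
    and v: "v \<in> words columns l" "v' \<in> words columns l"
    and eq1: "\<lfloor>3 ^ (n + l) * centre w v $ 1\<rfloor> = \<lfloor>3 ^ (n + l) * centre w' v' $ 1\<rfloor>"
    and eq2: "\<lfloor>centre w v $ 2 / a ^ n\<rfloor> = \<lfloor>centre w' v' $ 2 / a ^ n\<rfloor>"
  have len: "length w = n" "length w' = n" "length v = l" "length v' = l"
    using w v by (auto dest: words_length)
  have "midpoint (w @ v) = midpoint (w' @ v')"
    using eq1 by (intro midpoint_eqI) (simp_all add: len centre_def hword_append)
  then have eq: "hword w (midpoint v) = hword w' (midpoint v')" by (simp add: hword_append)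
  have "w = w'"
  proof (rule ccontr)
    assume "w \<noteq> w'"
    have sq: "(vector [midpoint x, 0] :: real^2) \<in> unit_square" for x
      unfolding in_unit_square using hword_in_unit[of "1/2" x] by simp
    have "a ^ n \<le> \<bar>centre w v $ 2 - centre w' v' $ 2\<bar>" unfolding centre_def
      by (rule vertical_separation[OF w \<open>w \<noteq> w'\<close> sq sq]) (simp_all add: eq)
    then have "1 \<le> \<bar>centre w v $ 2 / a ^ n - centre w' v' $ 2 / a ^ n\<bar>"
      using a_pos by (simp add: diff_divide_distrib[symmetric] abs_divide)
    then show False using eq2 by linarith
  qed
  moreover from this have "midpoint v = midpoint v'" using eq by (simp add: hword_inj)
  then have "v = v'" using hword_columns_inj[OF v, of "1/2" "1/2"] by simp
  ultimately show "w = w' \<and> v = v'" by simp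
qed

text \<open>The cells of the centres of these squares lie in a window of \<open>4 * K + 1\<close> columns and 7 rows:
  a centre is vertically at most \<open>1.5 * a ^ n\<close> away from every point of its square, and the set itself adds
  another \<open>a ^ n\<close>.\<close>

lemma card_blocks_met:
  assumes lower: "1 / 3 ^ (n + l) \<le> a ^ n" and upper: "a ^ n \<le> real K / 3 ^ (n + l)"
    and V: "\<And>x y. x \<in> V \<Longrightarrow> y \<in> V \<Longrightarrow> dist x y \<le> a ^ n"
  shows "card {(w, v) \<in> words letters n \<times> words columns l. block w v \<inter> V \<noteq> {}} \<le> (4 * K + 1) * 7"
proof (cases "V = {}")
  case False
  then obtain u where u: "u \<in> V" by blast
  define P where "P = {(w, v) \<in> words letters n \<times> words columns l. block w v \<inter> V \<noteq> {}}"
  define f where "f = (\<lambda>(w, v). (\<lfloor>3 ^ (n + l) * centre w v $ 1\<rfloor>, \<lfloor>centre w v $ 2 / a ^ n\<rfloor>))"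
  let ?x = "\<lfloor>3 ^ (n + l) * u $ 1\<rfloor>" and ?y = "\<lfloor>u $ 2 / a ^ n\<rfloor>"
  have "f ` P \<subseteq> {?x - 2 * int K .. ?x + 2 * int K} \<times> {?y - 3 .. ?y + 3}"
  proof (rule image_subsetI)
    fix b assume "b \<in> P"
    then obtain w v p where b: "b = (w, v)" and w: "w \<in> words letters n" and v: "v \<in> words columns l"
      and p: "p \<in> block w v" "p \<in> V" by (auto simp: P_def)
    have len: "length w = n" "length v = l" using w v by (auto dest: words_length)
    have up: "\<bar>u$i - p$i\<bar> \<le> a ^ n" for i
      using coordinate_le_dist[of u i p] V[OF u p(2)] by linarith
    have "1 / 3 ^ (n + l) \<le> real K / 3 ^ (n + l)" using lower upper by linarith
    then have "\<bar>u$1 - centre w v $ 1\<bar> \<le> 2 * real K / 3 ^ (n + l)"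
      using block_near_centre(1)[OF p(1)] up[of 1] upper by (simp add: len)
    then have "3 ^ (n + l) * \<bar>u$1 - centre w v $ 1\<bar> \<le> 2 * real K"
      by (simp add: field_simps)
    then have "\<bar>3 ^ (n + l) * u$1 - 3 ^ (n + l) * centre w v $ 1\<bar> \<le> 2 * real K"
      by (simp add: abs_mult right_diff_distrib[symmetric])
    then have 1: "\<lfloor>3 ^ (n + l) * centre w v $ 1\<rfloor> \<in> {?x - 2 * int K .. ?x + 2 * int K}"
      by (simp; linarith)
    have "\<bar>u$2 - centre w v $ 2\<bar> \<le> 3 * a ^ n"
      using block_near_centre(2)[OF p(1)] up[of 2] lower a_pos by (simp add: len)
    then have "\<bar>u$2 / a ^ n - centre w v $ 2 / a ^ n\<bar> \<le> 3"
      using a_pos by (simp add: diff_divide_distrib[symmetric] abs_divide divide_le_eq)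
    then have 2: "\<lfloor>centre w v $ 2 / a ^ n\<rfloor> \<in> {?y - 3 .. ?y + 3}" by (simp; linarith)
    show "f b \<in> {?x - 2 * int K .. ?x + 2 * int K} \<times> {?y - 3 .. ?y + 3}"
      using 1 2 by (simp add: f_def b)
  qed
  moreover have "inj_on f P"
    using centre_floor_inj[of n l] unfolding f_def by (rule inj_on_subset) (auto simp: P_def)
  ultimately have "card P \<le> card ({?x - 2 * int K .. ?x + 2 * int K} \<times> {?y - 3 .. ?y + 3})"
    by (intro card_inj_on_le[of f]) auto
  also have "\<dots> = (4 * K + 1) * 7"
    by (simp add: card_cartesian_product nat_add_distrib nat_mult_distrib)
  finally show ?thesis by (simp add: P_def)
qed auto

text \<open>The level \<open>m\<close> of triadic columns that match cylinders of level \<open>n\<close> in size. The factor \<open>k\<close>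
  makes both levels multiples of a given block length.\<close>

lemma matching_depth:
  assumes "0 < k"
  obtains m where "n \<le> m" "1 / 3 ^ (k * m) \<le> a ^ (k * n)" "a ^ (k * n) \<le> 3 ^ k / 3 ^ (k * m)"
proof -
  define Q where "Q m \<longleftrightarrow> 1 / 3 ^ (k * m) \<le> a ^ (k * n)" for m
  have "\<exists>i. (1/3::real) ^ i < a ^ (k * n)" using a_pos by (intro real_arch_pow_inv) auto
  then obtain i where i: "(1/3::real) ^ i < a ^ (k * n)" by blast
  have "(1/3::real) ^ (k * i) \<le> (1/3) ^ i" using assms by (intro power_decreasing) auto
  then have "Q i" using i by (simp add: Q_def power_one_over)
  define m where "m = (LEAST m. Q m)"
  have Qm: "Q m" unfolding m_def using \<open>Q i\<close> by (rule LeastI)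
  have "(1/3::real) ^ (k * m) \<le> (1/3) ^ (k * n)"
    using Qm a_power_le[of "k * n"] by (simp add: Q_def power_one_over)
  then have nm: "n \<le> m" using assms by (subst (asm) power_decreasing_iff) auto
  have "a ^ (k * n) \<le> 3 ^ k / 3 ^ (k * m)"
  proof (cases m)
    case 0
    then show ?thesis using nm by simp
  next
    case (Suc m')
    then have "\<not> Q m'" unfolding m_def using not_less_Least by (metis lessI)
    then show ?thesis by (simp add: Q_def Suc power_add)
  qed
  then show ?thesis using that nm Qm by (simp add: Q_def)
qed

definition depth :: "nat \<Rightarrow> nat" where
  "depth n = (SOME m. n \<le> m \<and> 1 / 3 ^ m \<le> a ^ n \<and> a ^ n \<le> 3 / 3 ^ m)"

lemma depth: "n \<le> depth n" "1 / 3 ^ depth n \<le> a ^ n" "a ^ n \<le> 3 / 3 ^ depth n"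
proof -
  have "\<exists>m. n \<le> m \<and> 1 / 3 ^ m \<le> a ^ n \<and> a ^ n \<le> 3 / 3 ^ m"
    using matching_depth[of 1 n] by auto
  then have "n \<le> depth n \<and> 1 / 3 ^ depth n \<le> a ^ n \<and> a ^ n \<le> 3 / 3 ^ depth n"
    unfolding depth_def by (rule someI_ex)
  then show "n \<le> depth n" "1 / 3 ^ depth n \<le> a ^ n" "a ^ n \<le> 3 / 3 ^ depth n" by auto
qed

definition squares :: "nat \<Rightarrow> (nat list \<times> nat list) set" where
  "squares n = words letters n \<times> words columns (depth n - n)"

lemma finite_squares: "finite (squares n)"
  by (simp add: squares_def finite_words)

lemma squares_length:
  assumes "(w, v) \<in> squares n"
  shows "length w = n" "length w + length v = depth n"
  using assms depth(1)[of n] by (auto simp: squares_def dest!: words_length)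

lemma card_squares: "real (card (squares n)) = (5/3) ^ n * 3 ^ depth n"
proof -
  have "card columns = 3" by simp
  then have "real (card (squares n)) = 5 ^ n * 3 ^ (depth n - n)"
    by (simp add: squares_def card_cartesian_product card_words)
  then show ?thesis using depth(1)[of n] by (simp add: power_diff power_divide)
qed

lemma card_squares_bounds:
  "(5 / (3 * a)) ^ n \<le> card (squares n)" "card (squares n) \<le> 3 * (5 / (3 * a)) ^ n"
proof -
  have eq: "(5 / (3 * a)) ^ n = (5/3) ^ n * (1 / a ^ n)"
    by (simp add: power_divide power_mult_distrib)
  have "1 / a ^ n \<le> 3 ^ depth n" "3 ^ depth n \<le> 3 * (1 / a ^ n)"
    using depth(2,3)[of n] a_pos by (simp_all add: field_simps)
  from mult_left_mono[OF this(1), of "(5/3) ^ n"] mult_left_mono[OF this(2), of "(5/3) ^ n"]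
  show "(5 / (3 * a)) ^ n \<le> card (squares n)" "card (squares n) \<le> 3 * (5 / (3 * a)) ^ n"
    unfolding eq card_squares by (simp_all add: mult.commute)
qed

lemma square_diameter:
  assumes "(w, v) \<in> squares n"
  shows "bounded (block w v)" "diameter (block w v) \<le> 2 / 3 ^ depth n + a ^ n"
proof -
  have d: "dist p q \<le> 2 / 3 ^ depth n + a ^ n" if "p \<in> block w v" "q \<in> block w v" for p q
    using block_dist[OF that] squares_length[OF assms] by simp
  then show "bounded (block w v)" unfolding bounded_two_points by blast
  show "diameter (block w v) \<le> 2 / 3 ^ depth n + a ^ n"
    using d a_pos by (intro diameter_le) (auto simp: dist_norm intro!: add_nonneg_nonneg)
qed

lemma squares_cover: "Lambda a \<subseteq> (\<Union>(w, v)\<in>squares n. block w v)"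
proof
  fix p assume "p \<in> Lambda a"
  then obtain x q where x: "x \<in> words letters (depth n)" "q \<in> Lambda a" "p = zword a x q"
    using Lambda_unfold[of "depth n"] by blast
  have w: "take n x \<in> words letters n" "drop n x \<in> words letters (depth n - n)"
    using x(1) depth(1)[of n] by (auto intro: take_in_words drop_in_words)
  have "p \<in> block (take n x) (column_word (drop n x))"
    using zword_in_block[OF _ w(2), of q "take n x"] x Lambda_unit_square by auto
  then show "p \<in> (\<Union>(w, v)\<in>squares n. block w v)"
    using w column_word_in_words[OF w(2)] by (auto simp: squares_def)
qed

end

section \<open>Box dimension\<close>

lemma covering_number_le:
  assumes "finite C" "S \<subseteq> \<Union>C" "\<And>U. U \<in> C \<Longrightarrow> bounded U \<and> diameter U \<le> \<delta>"
  shows "covering_number \<delta> S \<le> card C"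
  unfolding covering_number_def using assms by (intro Least_le) blast

lemma covering_number_attained:
  assumes "finite C" "S \<subseteq> \<Union>C" "\<And>U. U \<in> C \<Longrightarrow> bounded U \<and> diameter U \<le> \<delta>"
  obtains C' where "finite C'" "S \<subseteq> \<Union>C'" "\<And>U. U \<in> C' \<Longrightarrow> bounded U \<and> diameter U \<le> \<delta>"
    "card C' = covering_number \<delta> S"
proof -
  have "\<exists>n. \<exists>C. finite C \<and> card C = n \<and> S \<subseteq> \<Union>C \<and> (\<forall>U\<in>C. bounded U \<and> diameter U \<le> \<delta>)"
    using assms by blast
  from LeastI_ex[OF this] show ?thesis
    unfolding covering_number_def[symmetric] using that by blast
qed

lemma box_dim_eqI:
  assumes "((\<lambda>\<delta>. ln (real (covering_number \<delta> S)) / (- ln \<delta>)) \<longlongrightarrow> D) (at_right 0)"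
  shows "has_box_dim S" "box_dim S = ereal D"
proof -
  have lim: "((\<lambda>\<delta>. ereal (ln (real (covering_number \<delta> S)) / (- ln \<delta>))) \<longlongrightarrow> ereal D) (at_right 0)"
    using assms by simp
  have "upper_box_dim S = ereal D" "lower_box_dim S = ereal D"
    unfolding upper_box_dim_def lower_box_dim_def
    using lim_imp_Limsup[OF _ lim] lim_imp_Liminf[OF _ lim] by simp_all
  then show "has_box_dim S" "box_dim S = ereal D" by (simp_all add: has_box_dim_def box_dim_def)
qed

context zipper
begin

lemma covering_number_upper:
  assumes "3 * a ^ n \<le> \<delta>"
  shows "covering_number \<delta> (Lambda a) \<le> card (squares n)"
proof -
  define C where "C = (\<lambda>(w, v). block w v) ` squares n"
  have "covering_number \<delta> (Lambda a) \<le> card C"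
  proof (rule covering_number_le)
    show "finite C" using finite_squares by (simp add: C_def)
    show "Lambda a \<subseteq> \<Union>C" using squares_cover[of n] by (simp add: C_def)
    show "bounded U \<and> diameter U \<le> \<delta>" if "U \<in> C" for U
      using that square_diameter[of _ _ n] depth(2)[of n] assms by (fastforce simp: C_def)
  qed
  also have "\<dots> \<le> card (squares n)" unfolding C_def by (rule card_image_le[OF finite_squares])
  finally show ?thesis .
qed

text \<open>Every approximate square contains a point of the attractor, and a set of diameter at most
  \<open>\<delta>\<close> meets no more than \<open>91 = (4 * 3 + 1) * 7\<close> squares.\<close>

lemma covering_number_lower:
  assumes "0 < \<delta>" "\<delta> \<le> a ^ n"
  shows "card (squares n) \<le> 91 * covering_number \<delta> (Lambda a)"
proof -
  \<comment> \<open>Covers by sets of diameter at most \<open>\<delta>\<close> exist: take sufficiently small squares.\<close>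
  have "\<exists>i. (1/3::real) ^ i < \<delta> / 3" using assms(1) by (intro real_arch_pow_inv) auto
  then obtain i where "(1/3::real) ^ i < \<delta> / 3" by blast
  then have i: "3 * a ^ i \<le> \<delta>" using a_power_le[of i] by linarith
  let ?C = "(\<lambda>(w, v). block w v) ` squares i"
  have "finite ?C" using finite_squares by simp
  moreover have "Lambda a \<subseteq> \<Union>?C" using squares_cover[of i] by simp
  moreover have "bounded U \<and> diameter U \<le> \<delta>" if "U \<in> ?C" for U
    using that square_diameter[of _ _ i] depth(2)[of i] i by fastforce
  ultimately obtain C where C: "finite C" "Lambda a \<subseteq> \<Union>C"
    "\<And>U. U \<in> C \<Longrightarrow> bounded U \<and> diameter U \<le> \<delta>" "card C = covering_number \<delta> (Lambda a)"
    using covering_number_attained[of ?C "Lambda a" \<delta>] by metis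
  define M where "M U = {(w, v) \<in> squares n. block w v \<inter> U \<noteq> {}}" for U
  have M: "card (M U) \<le> 91" if "U \<in> C" for U
  proof -
    have "dist x y \<le> a ^ n" if "x \<in> U" "y \<in> U" for x y
      using diameter_bounded_bound[OF _ that] C(3)[OF \<open>U \<in> C\<close>] assms(2) by auto
    then show ?thesis
      using card_blocks_met[of n "depth n - n" 3 U] depth[of n] by (simp add: M_def squares_def)
  qed
  have "squares n \<subseteq> (\<Union>U\<in>C. M U)"
  proof clarify
    fix w v assume wv: "(w, v) \<in> squares n"
    then have w: "w \<in> words letters n" and v: "v \<in> words columns (depth n - n)"
      by (auto simp: squares_def)
    have v': "v \<in> words letters (depth n - n)" using v words_mono[OF columns_subset_letters] by blast
    let ?p = "zword a (w @ v) 0"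
    have "?p \<in> Lambda a" using append_in_words[OF w v'] zero_in_Lambda by (rule zword_in_Lambda)
    moreover have "column_word v = v"
    proof -
      have "midpoint (column_word v) = midpoint v" by (rule midpoint_column_word[OF v'])
      then show ?thesis
        using hword_columns_inj[OF column_word_in_words[OF v'] v, of "1/2" "1/2"] by simp
    qed
    then have "?p \<in> block w v" using zword_in_block[OF _ v', of 0 w] by (simp add: in_unit_square)
    ultimately show "(w, v) \<in> (\<Union>U\<in>C. M U)" using C(2) wv by (auto simp: M_def)
  qed
  moreover have "finite (M U)" for U
    by (rule finite_subset[OF _ finite_squares[of n]]) (auto simp: M_def)
  ultimately have "card (squares n) \<le> card (\<Union>U\<in>C. M U)" using C(1) by (intro card_mono) auto
  also have "\<dots> \<le> (\<Sum>U\<in>C. card (M U))" by (rule card_UN_le[OF C(1)])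
  also have "\<dots> \<le> (\<Sum>U\<in>C. 91)" using M by (rule sum_mono)
  finally show ?thesis using C(4) by simp
qed

lemma ln_a_neg: "ln a < 0"
  using a_pos a_le by simp

lemma ln_covering_number_bounds:
  assumes "0 < \<delta>" "\<delta> < 1"
  defines "L \<equiv> ln \<delta> / ln a" and "b \<equiv> 5 / (3 * a)"
  shows "(L - 1) * ln b - ln 91 \<le> ln (covering_number \<delta> (Lambda a))"
    and "ln (covering_number \<delta> (Lambda a)) \<le> ln 3 + (L + 2) * ln b"
proof -
  have b: "1 < b" using a_pos a_le by (simp add: b_def)
  have L: "0 \<le> L" using assms(1,2) ln_a_neg by (simp add: L_def divide_nonpos_neg)
  \<comment> \<open>Squares of level \<open>n\<close> are at least as large as \<open>\<delta>\<close>; two levels further down they fit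
    into sets of diameter \<open>\<delta>\<close>, because \<open>3 * a \<le> 1\<close>.\<close>
  define n where "n = nat \<lfloor>L\<rfloor>"
  have n: "real n \<le> L" "L < real n + 1" using L by (auto simp: n_def)
  have lnd: "ln \<delta> = L * ln a" using ln_a_neg by (simp add: L_def)
  have "ln \<delta> \<le> real n * ln a" unfolding lnd using n ln_a_neg by (intro mult_right_mono_neg) auto
  then have "ln \<delta> \<le> ln (a ^ n)" using a_pos by (simp add: ln_realpow)
  then have low: "\<delta> \<le> a ^ n" using assms(1) a_pos by (subst (asm) ln_le_cancel_iff) auto
  have "real (n + 1) * ln a \<le> ln \<delta>" unfolding lnd using n ln_a_neg by (intro mult_right_mono_neg) auto
  then have "ln (a ^ (n + 1)) \<le> ln \<delta>" using a_pos by (simp add: ln_realpow del: power_Suc)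
  then have "a ^ (n + 1) \<le> \<delta>" using assms(1) a_pos by (subst (asm) ln_le_cancel_iff) auto
  moreover have "a * a ^ (n + 1) \<le> 1/5 * a ^ (n + 1)" using a_pos a_le by (intro mult_right_mono) auto
  ultimately have "3 * (a * a ^ (n + 1)) \<le> \<delta>" using assms(1) by linarith
  then have up: "3 * a ^ (n + 2) \<le> \<delta>" by simp
  let ?N = "covering_number \<delta> (Lambda a)"
  have 1: "b ^ n \<le> 91 * real ?N"
    using card_squares_bounds(1)[of n] covering_number_lower[OF assms(1) low] unfolding b_def by linarith
  have "0 < b ^ n" using b by simp
  then have N: "real ?N > 0" using 1 by linarith
  have "real n * ln b = ln (b ^ n)" using b by (simp add: ln_realpow)
  also have "\<dots> \<le> ln (91 * real ?N)" using 1 b N by (subst ln_le_cancel_iff) auto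
  also have "\<dots> = ln 91 + ln ?N" using N by (subst ln_mult) auto
  finally have "real n * ln b \<le> ln 91 + ln ?N" .
  moreover have "(L - 1) * ln b \<le> real n * ln b" using n b by (intro mult_right_mono) auto
  ultimately show "(L - 1) * ln b - ln 91 \<le> ln ?N" by linarith
  have "real ?N \<le> 3 * b ^ (n + 2)"
    using card_squares_bounds(2)[of "n + 2"] covering_number_upper[OF up] unfolding b_def by linarith
  then have "ln ?N \<le> ln (3 * b ^ (n + 2))" using N b by (subst ln_le_cancel_iff) auto
  also have "\<dots> = ln 3 + real (n + 2) * ln b" using b by (subst ln_mult) (simp_all add: ln_realpow del: power_Suc)
  also have "\<dots> \<le> ln 3 + (L + 2) * ln b" using n b by (intro add_left_mono mult_right_mono) auto
  finally show "ln ?N \<le> ln 3 + (L + 2) * ln b" .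
qed

lemma box_dim_limit:
  "((\<lambda>\<delta>. ln (real (covering_number \<delta> (Lambda a))) / (- ln \<delta>)) \<longlongrightarrow> 1 + ln (3/5) / ln a) (at_right 0)"
proof -
  define b where "b = 5 / (3 * a)"
  define D where "D = 1 + ln (3/5) / ln a"
  have "ln (3/5) = - ln (5/3 :: real)" by (simp add: ln_div)
  moreover have "ln b = ln (5/3) - ln a" using a_pos by (simp add: b_def ln_div ln_mult)
  ultimately have D: "D = - (ln b / ln a)" using ln_a_neg by (simp add: D_def diff_divide_distrib)
  have top: "filterlim (\<lambda>\<delta>. - ln \<delta> :: real) at_top (at_right 0)"
    by (rule filterlim_compose[OF filterlim_uminus_at_top_at_bot ln_at_0])
  have small: "((\<lambda>\<delta>. c / (- ln \<delta>)) \<longlongrightarrow> 0) (at_right 0)" for c :: real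
    by (rule real_tendsto_divide_at_top[OF tendsto_const top])
  have ev: "eventually (\<lambda>\<delta>. \<delta> \<in> {0<..<1}) (at_right (0::real))"
    by (rule eventually_at_right_real) simp
  have split: "(D * (- x) + c) / (- x) = D + c / (- x)" if "x < 0" for x c :: real
    using that by (simp only: add_divide_distrib) simp
  show ?thesis unfolding D_def[symmetric]
  proof (rule tendsto_sandwich)
    show "((\<lambda>\<delta>. D + (- ln b - ln 91) / (- ln \<delta>)) \<longlongrightarrow> D) (at_right 0)"
      using tendsto_add[OF tendsto_const[of D] small] by simp
    show "((\<lambda>\<delta>. D + (ln 3 + 2 * ln b) / (- ln \<delta>)) \<longlongrightarrow> D) (at_right 0)"
      using tendsto_add[OF tendsto_const[of D] small] by simp
    show "eventually (\<lambda>\<delta>. D + (- ln b - ln 91) / (- ln \<delta>)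
        \<le> ln (real (covering_number \<delta> (Lambda a))) / (- ln \<delta>)) (at_right 0)"
      using ev
    proof eventually_elim
      case (elim \<delta>)
      then have neg: "ln \<delta> < 0" by simp
      have "D * (- ln \<delta>) = (ln \<delta> / ln a) * ln b" by (simp add: D)
      then have "D * (- ln \<delta>) + (- ln b - ln 91) \<le> ln (real (covering_number \<delta> (Lambda a)))"
        using ln_covering_number_bounds(1)[of \<delta>] elim by (simp add: b_def algebra_simps)
      then have "(D * (- ln \<delta>) + (- ln b - ln 91)) / (- ln \<delta>) \<le> ln (real (covering_number \<delta> (Lambda a))) / (- ln \<delta>)"
        using neg by (intro divide_right_mono) auto
      then show ?case unfolding split[OF neg] .
    qed
    show "eventually (\<lambda>\<delta>. ln (real (covering_number \<delta> (Lambda a))) / (- ln \<delta>)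
        \<le> D + (ln 3 + 2 * ln b) / (- ln \<delta>)) (at_right 0)"
      using ev
    proof eventually_elim
      case (elim \<delta>)
      then have neg: "ln \<delta> < 0" by simp
      have "D * (- ln \<delta>) = (ln \<delta> / ln a) * ln b" by (simp add: D)
      then have "ln (real (covering_number \<delta> (Lambda a))) \<le> D * (- ln \<delta>) + (ln 3 + 2 * ln b)"
        using ln_covering_number_bounds(2)[of \<delta>] elim by (simp add: b_def algebra_simps)
      then have "ln (real (covering_number \<delta> (Lambda a))) / (- ln \<delta>) \<le> (D * (- ln \<delta>) + (ln 3 + 2 * ln b)) / (- ln \<delta>)"
        using neg by (intro divide_right_mono) auto
      then show ?case unfolding split[OF neg] .
    qed
  qed
qed

end

section \<open>Upper bound for the Hausdorff dimension\<close>

text \<open>Otherwise iterating \<open>f\<close> would push \<open>c\<close> below 0. For the frequency \<open>c n\<close> of middle letters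
  among the first \<open>n\<close> and \<open>f = depth\<close>, it does at infinitely many \<open>n\<close> what
  convergence of the frequencies would do at all large \<open>n\<close>.\<close>

lemma bounded_below_not_always_dropping:
  fixes c :: "nat \<Rightarrow> real" and f :: "nat \<Rightarrow> nat"
  assumes "\<And>n. 0 \<le> c n" and "\<And>n. n \<le> f n" and "0 < e"
  shows "\<exists>n\<ge>N. c n - e \<le> c (f n)"
proof (rule ccontr)
  assume "\<not> ?thesis"
  then have drop: "c (f n) < c n - e" if "N \<le> n" for n
    using that by (meson not_le)
  have iter: "N \<le> (f ^^ k) N \<and> c ((f ^^ k) N) \<le> c N - real k * e" for k
  proof (induction k)
    case (Suc k)
    then show ?case using drop[of "(f ^^ k) N"] assms(2)[of "(f ^^ k) N"]
      by (simp add: algebra_simps)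
  qed simp
  obtain k :: nat where "c N < real k * e" using reals_Archimedean3[OF assms(3)] by blast
  then show False using iter[of k] assms(1)[of "(f ^^ k) N"] by linarith
qed

context zipper
begin

definition \<theta> :: real where
  "\<theta> = ln 3 / (- ln a)"

definition Z :: real where
  "Z = 2 + 3 powr \<theta>"

definition hdim :: real where
  "hdim = 1 / ln 3 * ln Z"

lemma theta_pos: "0 < \<theta>"
  using ln_a_neg by (simp add: \<theta>_def divide_pos_neg)

lemma Z_gt_2: "2 < Z"
  by (simp add: Z_def)

lemma hdim_pos: "0 < hdim"
  using Z_gt_2 by (simp add: hdim_def)

lemma three_powr_hdim: "3 powr (hdim * x) = Z powr x"
  using Z_gt_2 by (simp add: hdim_def powr_def)

lemma theta_upper:
  assumes "1 / 3 ^ m \<le> a ^ n"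
  shows "real n \<le> \<theta> * real m"
proof -
  have "ln (1 / 3 ^ m) \<le> ln (a ^ n)" using assms a_pos by (subst ln_le_cancel_iff) auto
  then have "- (real m * ln 3) \<le> real n * ln a" using a_pos by (simp add: ln_div ln_realpow)
  then show ?thesis using ln_a_neg by (simp add: \<theta>_def field_simps)
qed

lemma theta_lower:
  assumes "a ^ n \<le> 3 ^ k / 3 ^ m"
  shows "\<theta> * (real m - real k) \<le> real n"
proof -
  have "ln (a ^ n) \<le> ln (3 ^ k / 3 ^ m)" using assms a_pos by (subst ln_le_cancel_iff) auto
  then have "real n * ln a \<le> real k * ln 3 - real m * ln 3" using a_pos by (simp add: ln_div ln_realpow)
  then show ?thesis using ln_a_neg by (simp add: \<theta>_def field_simps)
qed

text \<open>For a square of level \<open>n\<close>, the number \<open>3 powr weight w v / Z ^ depth n\<close> is its mass under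
  McMullen's measure: the letters of \<open>w\<close> are prescribed exactly, those after them only up to their
  columns.\<close>

definition weight :: "nat list \<Rightarrow> nat list \<Rightarrow> real" where
  "weight w v = \<theta> * real (middle_count v) + (\<theta> - 1) * real (middle_count w)"

definition heavy :: "real \<Rightarrow> nat \<Rightarrow> (nat list \<times> nat list) set" where
  "heavy e n = {(w, v) \<in> squares n. - e * real (depth n) \<le> weight w v}"

lemma finite_heavy: "finite (heavy e n)"
  by (rule finite_subset[OF _ finite_squares[of n]]) (auto simp: heavy_def)

lemma sum_weights: "(\<Sum>(w, v)\<in>squares n. 3 powr weight w v) = Z ^ depth n"
proof -
  have "(\<Sum>(w, v)\<in>squares n. 3 powr weight w v)
     = (\<Sum>w\<in>words letters n. \<Sum>v\<in>words columns (depth n - n).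
          3 powr ((\<theta> - 1) * real (middle_count w)) * 3 powr (\<theta> * real (middle_count v)))"
    unfolding squares_def sum.cartesian_product by (simp add: weight_def powr_add[symmetric] add.commute)
  also have "\<dots> = Z ^ n * Z ^ (depth n - n)"
    unfolding sum_product[symmetric] sum_words_letters sum_words_columns Z_def ..
  also have "\<dots> = Z ^ depth n" using depth(1)[of n] by (simp add: power_add[symmetric])
  finally show ?thesis .
qed

text \<open>The masses of all squares of level \<open>n\<close> add up to 1 (\<open>sum_weights\<close>), so the reciprocal of
  the mass of a heavy square bounds their number.\<close>

lemma card_heavy: "real (card (heavy e n)) \<le> 3 powr ((hdim + e) * real (depth n))"
proof -
  let ?m = "real (depth n)"
  have "real (card (heavy e n)) * 3 powr (- e * ?m) = (\<Sum>(w, v)\<in>heavy e n. 3 powr (- e * ?m))"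
    by simp
  also have "\<dots> \<le> (\<Sum>(w, v)\<in>heavy e n. 3 powr weight w v)"
    by (intro sum_mono) (auto simp: heavy_def)
  also have "\<dots> \<le> (\<Sum>(w, v)\<in>squares n. 3 powr weight w v)"
    by (intro sum_mono2 finite_squares) (auto simp: heavy_def)
  also have "\<dots> = 3 powr (hdim * ?m)"
    using Z_gt_2 by (simp add: sum_weights three_powr_hdim powr_realpow)
  finally have "real (card (heavy e n)) * 3 powr (- e * ?m) * 3 powr (e * ?m)
      \<le> 3 powr (hdim * ?m) * 3 powr (e * ?m)" by (intro mult_right_mono) auto
  then show ?thesis by (simp add: powr_add[symmetric] mult.assoc distrib_right)
qed

text \<open>With \<open>c n\<close> the frequency of middle letters in the coding of \<open>p\<close>, the weight of the square of
  level \<open>n\<close> around \<open>p\<close> is \<open>\<theta> * m * c m - n * c n\<close> for \<open>m = depth n\<close>. As \<open>\<theta> * m \<ge> n\<close>, this is at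
  least \<open>n * (c m - c n)\<close>, and \<open>c m \<ge> c n - e\<close> for infinitely many \<open>n\<close>.\<close>

lemma infinitely_often_heavy:
  assumes "p \<in> Lambda a" and "0 < e"
  obtains n w v where "N \<le> n" "(w, v) \<in> heavy e n" "p \<in> block w v"
proof -
  obtain \<omega> where \<omega>: "\<And>n. \<omega> n \<in> letters" "\<And>n. \<exists>q\<in>Lambda a. p = zword a (map \<omega> [0..<n]) q"
    using Lambda_coding[OF assms(1)] by blast
  define S where "S n = middle_count (map \<omega> [0..<n])" for n
  define c where "c n = real (S n) / real n" for n
  have S: "real (S n) = c n * real n" for n
    by (cases "n = 0") (simp_all add: c_def S_def)
  obtain n where n: "N \<le> n" "c n - e \<le> c (depth n)"
    using bounded_below_not_always_dropping[of c depth e N] depth(1) assms(2) by (auto simp: c_def)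
  define w u where "w = map \<omega> [0..<n]" and "u = map \<omega> [n..<depth n]"
  have wu: "map \<omega> [0..<depth n] = w @ u"
    unfolding w_def u_def map_append[symmetric]
    using depth(1)[of n] upt_add_eq_append[of 0 n "depth n - n"] by simp
  have w: "w \<in> words letters n" and u: "u \<in> words letters (depth n - n)"
    using \<omega>(1) by (auto simp: w_def u_def words_def)
  obtain q where q: "q \<in> Lambda a" "p = zword a (w @ u) q" using \<omega>(2)[of "depth n"] wu by auto
  have "p \<in> block w (column_word u)"
    using zword_in_block[OF _ u, of q w] q Lambda_unit_square by auto
  moreover have "(w, column_word u) \<in> heavy e n"
  proof -
    have "S (depth n) = middle_count w + middle_count u" "S n = middle_count w"
      by (simp_all add: S_def wu) (simp add: w_def)
    then have "weight w (column_word u) = \<theta> * real (S (depth n)) - real (S n)"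
      by (simp add: weight_def algebra_simps)
    also have "\<dots> = c (depth n) * (\<theta> * real (depth n)) - c n * real n"
      by (simp add: S)
    finally have W: "weight w (column_word u) = \<dots>" .
    have "c (depth n) * real n \<le> c (depth n) * (\<theta> * real (depth n))"
      using theta_upper[OF depth(2)[of n]] by (intro mult_left_mono) (auto simp: c_def)
    moreover have "(c n - e) * real n \<le> c (depth n) * real n" using n(2) by (intro mult_right_mono) auto
    moreover have "e * real n \<le> e * real (depth n)" using assms(2) depth(1)[of n] by simp
    ultimately have "- e * real (depth n) \<le> weight w (column_word u)"
      unfolding W by (simp add: left_diff_distrib)
    then show ?thesis using w column_word_in_words[OF u] by (auto simp: heavy_def squares_def)
  qed
  ultimately show ?thesis using n(1) that by blast
qed

text \<open>The heavy squares of level \<open>n\<close> number at most \<open>3 powr ((hdim + e) * m)\<close> and have diameter at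
  most \<open>5 / 3 ^ m\<close>, where \<open>m = depth n \<ge> n\<close>. With \<open>s = hdim + 2 * e\<close>, the Hausdorff sum over all
  levels from \<open>N\<close> on is dominated by the tail of a geometric series.\<close>

lemma hausdorff_measure_above_hdim:
  assumes "hdim < s"
  shows "hausdorff_measure s (Lambda a) = 0"
proof (rule hausdorff_measure_eq_0I)
  fix \<delta> \<eta> :: real assume \<delta>: "0 < \<delta>" and \<eta>: "0 < \<eta>"
  define e where "e = (s - hdim) / 2"
  have e: "0 < e" using assms by (simp add: e_def)
  have s: "0 < s" using assms hdim_pos by simp
  define r where "r = 3 powr (- e)"
  have r: "0 < r" "r < 1" using e by (simp_all add: r_def powr_less_one)
  have "(\<lambda>N. 5 powr s * r ^ N / (1 - r)) \<longlonglongrightarrow> 5 powr s * 0 / (1 - r)"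
    using r by (intro tendsto_intros LIMSEQ_power_zero) auto
  then have "eventually (\<lambda>N. 5 powr s * r ^ N / (1 - r) < \<eta>) sequentially"
    using \<eta> by (intro order_tendstoD(2)) auto
  moreover have "(\<lambda>N. 5 * (1/3) ^ N :: real) \<longlonglongrightarrow> 5 * 0"
    by (intro tendsto_intros LIMSEQ_power_zero) auto
  then have "eventually (\<lambda>N. 5 * (1/3) ^ N < \<delta>) sequentially"
    using \<delta> by (intro order_tendstoD(2)) auto
  ultimately have "eventually (\<lambda>N. 5 powr s * r ^ N / (1 - r) < \<eta> \<and> 5 * (1/3) ^ N < \<delta>) sequentially"
    by eventually_elim simp
  then obtain N where N: "5 powr s * r ^ N / (1 - r) < \<eta>" "5 * (1/3) ^ N < \<delta>"
    by (auto simp: eventually_sequentially)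
  define I where "I = (\<Union>n\<in>{N..}. heavy e n)"
  define U where "U = (\<lambda>(w, v). block w v)"
  have diam: "bounded (U b)" "diameter (U b) \<le> 5 / 3 ^ depth n" if "b \<in> heavy e n" for b n
    using that square_diameter[of _ _ n] depth(3)[of n] by (fastforce simp: U_def heavy_def)+
  have level: "(\<Sum>b\<in>heavy e n. diam_pow s (U b)) \<le> ennreal (5 powr s * r ^ n)" for n
  proof -
    let ?m = "real (depth n)"
    have one: "diam_pow s (U b) \<le> ennreal ((5 / 3 ^ depth n) powr s)" if "b \<in> heavy e n" for b
      using diam[OF that] s diameter_ge_0[of "U b"]
      by (auto simp: diam_pow_def intro!: ennreal_leI powr_mono2)
    have "(\<Sum>b\<in>heavy e n. diam_pow s (U b)) \<le> (\<Sum>b\<in>heavy e n. ennreal ((5 / 3 ^ depth n) powr s))"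
      using one by (rule sum_mono)
    also have "\<dots> = ennreal (real (card (heavy e n)) * (5 / 3 ^ depth n) powr s)"
      by (simp add: ennreal_mult' ennreal_of_nat_eq_real_of_nat)
    also have "\<dots> \<le> ennreal (5 powr s * r ^ n)"
    proof (rule ennreal_leI)
      have "(3 ^ depth n :: real) powr s = 3 powr (s * ?m)"
        by (simp add: powr_powr powr_realpow[symmetric] mult.commute)
      moreover have "(5 / 3 ^ depth n) powr s = 5 powr s / (3 ^ depth n) powr s"
        by (rule powr_divide)
      ultimately have "(5 / 3 ^ depth n) powr s = 5 powr s * 3 powr (- s * ?m)"
        by (simp add: powr_minus divide_inverse)
      then have "real (card (heavy e n)) * (5 / 3 ^ depth n) powr s
          \<le> 3 powr ((hdim + e) * ?m) * (5 powr s * 3 powr (- s * ?m))"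
        using card_heavy[of e n] by (simp add: mult_right_mono)
      also have "\<dots> = 5 powr s * 3 powr ((hdim + e) * ?m + - s * ?m)"
        unfolding powr_add by simp
      also have "(hdim + e) * ?m + - s * ?m = - e * ?m" by (simp add: e_def field_simps)
      also have "3 powr (- e * ?m) \<le> 3 powr (- e * real n)"
        using e depth(1)[of n] by (intro powr_mono) auto
      also have "3 powr (- e * real n) = r ^ n"
        by (simp add: r_def powr_realpow[symmetric] powr_powr)
      finally show "real (card (heavy e n)) * (5 / 3 ^ depth n) powr s \<le> 5 powr s * r ^ n" by simp
    qed
    finally show ?thesis .
  qed
  have "hausdorff_premeasure s \<delta> (Lambda a) \<le> ennreal (5 powr s * r ^ N / (1 - r))"
  proof (rule hausdorff_premeasure_le)
    show "Lambda a \<subseteq> (\<Union>b\<in>I. U b)"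
    proof
      fix p assume "p \<in> Lambda a"
      then obtain n w v where "N \<le> n" "(w, v) \<in> heavy e n" "p \<in> block w v"
        using infinitely_often_heavy[OF _ e, of p N] by blast
      then show "p \<in> (\<Union>b\<in>I. U b)" by (intro UN_I[of "(w, v)"]) (auto simp: I_def U_def)
    qed
    show "bounded (U b) \<and> diameter (U b) \<le> \<delta>" if "b \<in> I" for b
    proof -
      obtain n where n: "N \<le> n" "b \<in> heavy e n" using \<open>b \<in> I\<close> by (auto simp: I_def)
      have "5 * (1/3) ^ depth n \<le> 5 * ((1/3) ^ N :: real)"
        using n(1) depth(1)[of n] by (intro mult_left_mono power_decreasing) auto
      then show ?thesis using diam[OF n(2)] N(2) by (auto simp: power_one_over)
    qed
    show "0 \<le> \<delta>" using \<delta> by simp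
    fix F assume F: "finite F" "F \<subseteq> I"
    define lev where "lev b = length (fst b)" for b :: "nat list \<times> nat list"
    have lev: "lev b = n" if "b \<in> heavy e n" for b n
      using that squares_length(1)[of "fst b" "snd b" n] by (auto simp: heavy_def lev_def)
    have sub: "{b \<in> F. lev b = n} \<subseteq> heavy e n" "n \<in> lev ` F \<Longrightarrow> N \<le> n" for n
      using F(2) lev by (auto simp: I_def)
    have "(\<Sum>b\<in>F. diam_pow s (U b)) = (\<Sum>n\<in>lev ` F. \<Sum>b\<in>{b \<in> F. lev b = n}. diam_pow s (U b))"
      using F(1) by (rule sum.image_gen)
    also have "\<dots> \<le> (\<Sum>n\<in>lev ` F. \<Sum>b\<in>heavy e n. diam_pow s (U b))"
      using sub by (intro sum_mono sum_mono2 finite_heavy) auto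
    also have "\<dots> \<le> (\<Sum>n\<in>lev ` F. ennreal (5 powr s * r ^ n))"
      using level by (rule sum_mono)
    also have "\<dots> = ennreal (\<Sum>n\<in>lev ` F. 5 powr s * r ^ n)"
      using r by simp
    also have "\<dots> \<le> ennreal (5 powr s * r ^ N / (1 - r))"
    proof (rule ennreal_leI)
      have sums: "(\<lambda>k. 5 powr s * r ^ N * r ^ k) sums (5 powr s * r ^ N * (1 / (1 - r)))"
        using r by (intro sums_mult geometric_sums) auto
      have inj: "inj_on (\<lambda>n. n - N) (lev ` F)" 
        by (rule inj_onI) (use sub(2) eq_diff_iff in blast)
      have "(\<Sum>n\<in>lev ` F. 5 powr s * r ^ n) = (\<Sum>n\<in>lev ` F. 5 powr s * r ^ N * r ^ (n - N))"
        using sub(2) by (intro sum.cong) (auto simp: power_add[symmetric] mult.assoc)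
      also have "\<dots> = (\<Sum>k\<in>(\<lambda>n. n - N) ` lev ` F. 5 powr s * r ^ N * r ^ k)"
        by (simp add: sum.reindex[OF inj])
      also have "\<dots> \<le> 5 powr s * r ^ N * (1 / (1 - r))"
        unfolding sums_unique[OF sums]
        using F(1) r sums_summable[OF sums] by (intro sum_le_suminf) auto
      finally show "(\<Sum>n\<in>lev ` F. 5 powr s * r ^ n) \<le> 5 powr s * r ^ N / (1 - r)" by simp
    qed
    finally show "(\<Sum>b\<in>F. diam_pow s (U b)) \<le> ennreal (5 powr s * r ^ N / (1 - r))" .
  qed
  then show "hausdorff_premeasure s \<delta> (Lambda a) \<le> ennreal \<eta>"
    using N(1) by (meson ennreal_leI less_imp_le order_trans)
qed

end

section \<open>Lower bound for the Hausdorff dimension\<close>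

context zipper
begin

definition typed_words :: "nat \<Rightarrow> nat \<Rightarrow> nat list set" where
  "typed_words k j = {w \<in> words letters k. middle_count w = j}"

lemma typed_words_words: "typed_words k j \<subseteq> words letters k"
  by (auto simp: typed_words_def)

lemma finite_typed_words: "finite (typed_words k j)"
  using finite_subset[OF typed_words_words] by (simp add: finite_words)

text \<open>Pigeonhole: the \<open>k + 1\<close> possible values of the middle count share the total weight \<open>Z ^ k\<close>, and
  the loss of the factor \<open>k + 1\<close> is absorbed by lowering the exponent from \<open>hdim\<close> to \<open>s\<close>.\<close>

lemma large_typed_words:
  assumes "s < hdim"
  obtains k j where "0 < k" "3 powr (s * real k) \<le> real (card (typed_words k j)) * 3 powr ((\<theta> - 1) * real j)"
proof -
  define q where "q = 3 powr (hdim - s)"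
  have q: "1 < q" using assms by (simp add: q_def)
  have "(\<lambda>k. real (k + 1) / q ^ k) \<longlonglongrightarrow> 0" using q by real_asymp
  then have "eventually (\<lambda>k. real (k + 1) / q ^ k < 1) sequentially" by (rule order_tendstoD) simp
  then have "eventually (\<lambda>k. real (k + 1) / q ^ k < 1 \<and> 0 < k) sequentially"
    using eventually_gt_at_top[of 0] by eventually_elim auto
  then obtain k where k: "real (k + 1) / q ^ k < 1" "0 < k" by (auto simp: eventually_sequentially)
  have k1: "real (k + 1) \<le> q ^ k" using k(1) q by (simp add: divide_less_eq)
  define t where "t j = real (card (typed_words k j)) * 3 powr ((\<theta> - 1) * real j)" for j
  have "Z ^ k = (\<Sum>w\<in>words letters k. 3 powr ((\<theta> - 1) * real (middle_count w)))"
    by (simp add: sum_words_letters Z_def)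
  also have "\<dots> = (\<Sum>j\<in>{..k}. \<Sum>w\<in>typed_words k j. 3 powr ((\<theta> - 1) * real (middle_count w)))"
    unfolding typed_words_def using middle_count_le
    by (intro sum.group[symmetric]) (auto simp: finite_words dest!: words_length)
  also have "\<dots> = (\<Sum>j\<le>k. t j)" by (simp add: t_def typed_words_def)
  finally have Zt: "Z ^ k = (\<Sum>j\<le>k. t j)" .
  have "\<exists>j\<le>k. 3 powr (s * real k) \<le> t j"
  proof (rule ccontr)
    assume "\<not> ?thesis"
    then have "t j < 3 powr (s * real k)" if "j \<le> k" for j using that by (meson not_le)
    then have "(\<Sum>j\<le>k. t j) < (\<Sum>j\<le>k. 3 powr (s * real k))"
      by (intro sum_strict_mono) auto
    then have "Z ^ k < real (k + 1) * 3 powr (s * real k)" unfolding Zt by simp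
    also have "\<dots> \<le> q ^ k * 3 powr (s * real k)" using k1 by (intro mult_right_mono) auto
    also have "\<dots> = 3 powr (hdim * real k)"
      by (simp add: q_def powr_realpow[symmetric] powr_powr powr_add[symmetric] algebra_simps)
    also have "\<dots> = Z ^ k" using Z_gt_2 by (simp add: three_powr_hdim powr_realpow)
    finally show False by simp
  qed
  then show ?thesis using that k(2) by (auto simp: t_def)
qed

text \<open>A set of the size of a square of level \<open>k * n\<close> meets boundedly many such squares. To lie in a
  given square fixes the first \<open>n\<close> blocks of a sequence; for the blocks from \<open>n\<close> to \<open>m\<close> it fixes the
  column word, which leaves \<open>3\<close> choices for each of the \<open>j * (m - n)\<close> middle letters; the blocks
  after \<open>m\<close> are free.\<close>

lemma card_typed_words_met:
  assumes k: "0 < k" and nm: "n \<le> m" "m \<le> T"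
    and lower: "1 / 3 ^ (k * m) \<le> a ^ (k * n)" and upper: "a ^ (k * n) \<le> 3 ^ k / 3 ^ (k * m)"
    and V: "\<And>x y. x \<in> V \<Longrightarrow> y \<in> V \<Longrightarrow> dist x y \<le> a ^ (k * n)"
  shows "card {W \<in> words (typed_words k j) T. zword a (concat W) 0 \<in> V}
    \<le> (4 * 3 ^ k + 1) * 7 * (3 ^ (j * (m - n)) * card (typed_words k j) ^ (T - m))"
proof -
  let ?D = "typed_words k j"
  define S where "S = {W \<in> words ?D T. zword a (concat W) 0 \<in> V}"
  define mid where "mid W = concat (take (m - n) (drop n W))" for W :: "nat list list"
  define f where "f W = (concat (take n W), column_word (mid W))" for W
  define P where "P = {(w, v) \<in> words letters (k * n) \<times> words columns (k * (m - n)). block w v \<inter> V \<noteq> {}}"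
  have DW: "words ?D i \<subseteq> words (words letters k) i" for i by (rule words_mono[OF typed_words_words])
  have parts: "take n W \<in> words ?D n" "take (m - n) (drop n W) \<in> words ?D (m - n)"
      "drop m W \<in> words ?D (T - m)" if "W \<in> words ?D T" for W
    using that nm by (auto intro!: take_in_words drop_in_words)
  have mid: "mid W \<in> words letters (k * (m - n))" "middle_count (mid W) = j * (m - n)"
    if "W \<in> words ?D T" for W
  proof -
    show "mid W \<in> words letters (k * (m - n))"
      unfolding mid_def using parts(2)[OF that] DW by (intro concat_in_words) blast
    have "middle_count (mid W) = j * length (take (m - n) (drop n W))"
      unfolding mid_def using parts(2)[OF that]
      by (intro middle_count_concat) (auto simp: words_def typed_words_def)
    then show "middle_count (mid W) = j * (m - n)" using words_length[OF parts(2)[OF that]] by simp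
  qed
  have decomp: "W = take n W @ take (m - n) (drop n W) @ drop m W" for W :: "nat list list"
    using nm(1) by (metis append_take_drop_id drop_drop le_add_diff_inverse2)
  have "card S \<le> card P * (3 ^ (j * (m - n)) * card ?D ^ (T - m))"
  proof (rule card_le_sum_fibres[where f = f])
    show "finite P"
      by (rule finite_subset[of _ "words letters (k * n) \<times> words columns (k * (m - n))"])
        (auto simp: P_def finite_words)
    show "finite S"
      by (rule finite_subset[of _ "words ?D T"]) (auto simp: S_def finite_words finite_typed_words)
    show "f ` S \<subseteq> P"
    proof (rule image_subsetI)
      fix W assume "W \<in> S"
      then have W: "W \<in> words ?D T" "zword a (concat W) 0 \<in> V" by (auto simp: S_def)
      have pre: "concat (take n W) \<in> words letters (k * n)"
        using parts(1)[OF W(1)] DW by (intro concat_in_words) blast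
      have rest: "concat (drop m W) \<in> words letters (k * (T - m))"
        using parts(3)[OF W(1)] DW by (intro concat_in_words) blast
      have split: "concat W = concat (take n W) @ mid W @ concat (drop m W)"
        unfolding mid_def using arg_cong[OF decomp[of W], of concat] by simp
      have "zword a (concat (drop m W)) 0 \<in> unit_square"
        using rest by (intro zword_unit_square) (auto simp: in_unit_square simp del: mem_box)
      from zword_in_block[OF this mid(1)[OF W(1)], of "concat (take n W)"]
      have "zword a (concat W) 0 \<in> block (concat (take n W)) (column_word (mid W))"
        unfolding split zword_append .
      then show "f W \<in> P"
        using W(2) pre column_word_in_words[OF mid(1)[OF W(1)]] by (auto simp: f_def P_def)
    qed
    fix b assume "b \<in> P"
    then obtain w v where b: "b = (w, v)" "v \<in> words columns (k * (m - n))" by (auto simp: P_def)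
    show "card {W \<in> S. f W = b} \<le> 3 ^ (j * (m - n)) * card ?D ^ (T - m)"
    proof (cases "{W \<in> S. f W = b} = {}")
      case False
      then have cnt: "middle_count v = j * (m - n)"
        using mid(2) middle_count_column_word b(1) by (auto simp: S_def f_def)
      define F where "F = {u \<in> words letters (k * (m - n)). column_word u = v}"
      have "card {W \<in> S. f W = b} \<le> card (F \<times> words ?D (T - m))"
      proof (rule card_inj_on_le[of "\<lambda>W. (mid W, drop m W)"])
        show "inj_on (\<lambda>W. (mid W, drop m W)) {W \<in> S. f W = b}"
        proof (rule inj_onI)
          fix W W' assume W: "W \<in> {W \<in> S. f W = b}" "W' \<in> {W \<in> S. f W = b}"
            and eq: "(mid W, drop m W) = (mid W', drop m W')"
          have WD: "W \<in> words ?D T" "W' \<in> words ?D T" using W by (auto simp: S_def)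
          have "concat (take n W) = concat (take n W')" using W by (auto simp: f_def)
          then have "take n W = take n W'"
            by (rule inj_onD[OF inj_concat_words]) (use parts(1) WD DW in blast)+
          moreover have "take (m - n) (drop n W) = take (m - n) (drop n W')"
          proof -
            have "concat (take (m - n) (drop n W)) = concat (take (m - n) (drop n W'))"
              using eq by (simp add: mid_def)
            then show ?thesis
              by (rule inj_onD[OF inj_concat_words]) (use parts(2) WD DW in blast)+
          qed
          ultimately show "W = W'" using eq decomp[of W] decomp[of W'] by simp
        qed
        show "(\<lambda>W. (mid W, drop m W)) ` {W \<in> S. f W = b} \<subseteq> F \<times> words ?D (T - m)"
          using mid(1) parts(3) b(1) by (auto simp: S_def f_def F_def)
        show "finite (F \<times> words ?D (T - m))"
          by (simp add: F_def finite_words finite_typed_words)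
      qed
      also have "\<dots> = card F * card ?D ^ (T - m)"
        by (simp add: card_cartesian_product card_words finite_typed_words)
      also have "\<dots> \<le> 3 ^ (j * (m - n)) * card ?D ^ (T - m)"
        using card_column_word_fibre[OF b(2)] by (intro mult_right_mono) (simp_all add: F_def cnt)
      finally show ?thesis .
    qed (simp only: card.empty le0)
  qed
  moreover have "card P \<le> (4 * 3 ^ k + 1) * 7"
    unfolding P_def using lower upper V nm(1)
    by (intro card_blocks_met) (simp_all add: add_mult_distrib2[symmetric])
  ultimately show ?thesis unfolding S_def by (meson mult_right_mono le0 order_trans)
qed

text \<open>By \<open>card_typed_words_met\<close>, a set of diameter \<open>\<rho>\<close>, comparable to \<open>a ^ (k * n)\<close>, contains up to
  a constant at most the fraction \<open>3 ^ (j * (m - n)) / card D ^ m\<close> of the sequences over the set \<open>D\<close>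
  of selected blocks. Since \<open>n\<close> is about \<open>\<theta> * m\<close>, this is about \<open>(card D * 3 powr ((\<theta> - 1) * j))\<close> to
  the power \<open>- m\<close>. The choice of \<open>D\<close> bounds it by \<open>3 powr (- s * k * m)\<close>, which is comparable to
  \<open>\<rho> powr s\<close>.\<close>

lemma hausdorff_measure_below_hdim:
  assumes "0 \<le> s" "s < hdim"
  shows "hausdorff_measure s (Lambda a) \<noteq> 0"
proof -
  obtain k j where k: "0 < k"
    and large: "3 powr (s * real k) \<le> real (card (typed_words k j)) * 3 powr ((\<theta> - 1) * real j)"
    using large_typed_words[OF assms(2)] .
  let ?D = "typed_words k j"
  define \<alpha> where "\<alpha> = a ^ k"
  have \<alpha>: "0 < \<alpha>" "\<alpha> < 1"
    using a_pos a_le k by (auto simp: \<alpha>_def power_less_one_iff)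
  have cardD: "0 < real (card ?D)"
  proof (rule ccontr)
    assume "\<not> 0 < real (card ?D)"
    then have "card ?D = 0" by simp
    then show False using large powr_gt_zero[of 3 "s * real k"] by simp
  qed
  define c where "c = real ((4 * 3 ^ k + 1) * 7)"
  define C where "C = max 1 (c * 3 powr (\<theta> * real j) * \<alpha> powr (- s))"
  have c0: "0 \<le> c" by (simp add: c_def)
  show ?thesis
  proof (rule mass_distribution_principle[where X = "words ?D" and \<pi> = "\<lambda>T W. zword a (concat W) 0"])
    show "compact (Lambda a)" by (rule compact_Lambda)
    show "0 \<le> s" by (rule assms)
    show "finite (words ?D T)" for T by (simp add: finite_words finite_typed_words)
    show "words ?D T \<noteq> {}" for T
      using card_words[OF finite_typed_words, of k j T] cardD by auto
    show "zword a (concat W) 0 \<in> Lambda a" if "W \<in> words ?D T" for T W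
      using that concat_in_words[of W letters k T] words_mono[OF typed_words_words]
      by (intro zword_in_Lambda zero_in_Lambda) blast
    show "0 < C" by (simp add: C_def)
    fix \<rho> :: real assume \<rho>: "0 < \<rho>"
    show "\<exists>T0. \<forall>T\<ge>T0. \<forall>V. (\<forall>x\<in>V. \<forall>y\<in>V. dist x y \<le> \<rho>) \<longrightarrow>
      real (card {W \<in> words ?D T. zword a (concat W) 0 \<in> V}) \<le> C * \<rho> powr s * real (card (words ?D T))"
    proof (cases "\<rho> < 1")
      case False
      have "real (card {W \<in> words ?D T. zword a (concat W) 0 \<in> V}) \<le> C * \<rho> powr s * real (card (words ?D T))"
        for T V
      proof -
        have "real (card {W \<in> words ?D T. zword a (concat W) 0 \<in> V}) \<le> 1 * 1 * real (card (words ?D T))"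
          by (simp add: card_mono finite_words finite_typed_words)
        also have "\<dots> \<le> C * \<rho> powr s * real (card (words ?D T))"
          using False assms(1) by (intro mult_mono) (auto simp: C_def ge_one_powr_ge_zero)
        finally show ?thesis .
      qed
      then show ?thesis by blast
    next
      case True
      \<comment> \<open>Choose \<open>n\<close> with \<open>\<alpha> ^ Suc n \<le> \<rho> \<le> \<alpha> ^ n\<close>.\<close>
      define Q where "Q n \<longleftrightarrow> \<alpha> ^ Suc n \<le> \<rho>" for n
      have "\<exists>i. \<alpha> ^ i < \<rho>" using \<alpha> \<rho> by (intro real_arch_pow_inv) auto
      then obtain i where "\<alpha> ^ i < \<rho>" by blast
      moreover have "\<alpha> ^ Suc i \<le> \<alpha> ^ i" using \<alpha> by (intro power_decreasing) auto
      ultimately have "Q i" by (simp add: Q_def)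
      define n where "n = (LEAST n. Q n)"
      have Qn: "\<alpha> ^ Suc n \<le> \<rho>" using LeastI[of Q, OF \<open>Q i\<close>] by (simp add: n_def Q_def)
      have \<rho>n: "\<rho> \<le> \<alpha> ^ n"
      proof (cases n)
        case (Suc n')
        then have "\<not> Q n'" unfolding n_def using not_less_Least by (metis lessI)
        then show ?thesis by (simp add: Q_def Suc)
      qed (use True in simp)
      obtain m where m: "n \<le> m" "1 / 3 ^ (k * m) \<le> a ^ (k * n)" "a ^ (k * n) \<le> 3 ^ k / 3 ^ (k * m)"
        using matching_depth[OF k] .
      have key: "3 ^ (j * (m - n)) / real (card ?D) ^ m
          \<le> 3 powr (\<theta> * real j) * \<alpha> powr (- s) * \<rho> powr s"
      proof -
        have "\<theta> * (real (k * m) - real k) \<le> real (k * n)" by (rule theta_lower[OF m(3)])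
        then have "real k * (\<theta> * (real m - 1)) \<le> real k * real n" by (simp add: algebra_simps)
        then have \<theta>n: "\<theta> * (real m - 1) \<le> real n" using k by simp
        have "3 powr (s * real (k * m)) = (3 powr (s * real k)) ^ m"
          by (simp add: powr_realpow[symmetric] powr_powr mult_ac)
        also have "\<dots> \<le> (real (card ?D) * 3 powr ((\<theta> - 1) * real j)) ^ m"
          using large by (intro power_mono) auto
        also have "\<dots> = real (card ?D) ^ m * 3 powr ((\<theta> - 1) * real j * real m)"
          by (simp add: power_mult_distrib powr_realpow[symmetric] powr_powr)
        finally have 1: "3 powr (s * real (k * m)) \<le> real (card ?D) ^ m * 3 powr ((\<theta> - 1) * real j * real m)" .
        have "\<alpha> ^ n * 3 ^ (k * m) \<ge> 1"
          using m(2) by (simp add: \<alpha>_def power_mult[symmetric] field_simps)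
        then have "1 \<le> (\<alpha> ^ n * 3 ^ (k * m)) powr s" using assms(1) by (rule ge_one_powr_ge_zero)
        also have "\<dots> = (\<alpha> ^ n) powr s * 3 powr (s * real (k * m))"
          using \<alpha> by (simp add: powr_mult powr_realpow[symmetric] powr_powr mult_ac)
        also have "(\<alpha> ^ n) powr s = \<alpha> powr (- s) * (\<alpha> ^ Suc n) powr s"
          using \<alpha> by (simp add: powr_mult powr_minus field_simps)
        also have "(\<alpha> ^ Suc n) powr s \<le> \<rho> powr s" using Qn assms(1) \<alpha> by (intro powr_mono2) auto
        finally have "1 \<le> \<alpha> powr (- s) * \<rho> powr s * 3 powr (s * real (k * m))"
          using \<alpha> by (simp add: mult_right_mono mult_left_mono)
        also have "\<dots> \<le> \<alpha> powr (- s) * \<rho> powr s *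
            (real (card ?D) ^ m * 3 powr ((\<theta> - 1) * real j * real m))"
          using 1 by (intro mult_left_mono) auto
        finally have 2: "1 \<le> \<alpha> powr (- s) * \<rho> powr s *
            (real (card ?D) ^ m * 3 powr ((\<theta> - 1) * real j * real m))" .
        have "real j * (\<theta> * (real m - 1)) \<le> real j * real n" using \<theta>n by (intro mult_left_mono) auto
        then have exp: "real (j * (m - n)) + (\<theta> - 1) * real j * real m \<le> \<theta> * real j"
          using m(1) by (simp add: of_nat_diff algebra_simps)
        have "3 ^ (j * (m - n)) / real (card ?D) ^ m
          \<le> 3 ^ (j * (m - n)) / real (card ?D) ^ m * (\<alpha> powr (- s) * \<rho> powr s *
            (real (card ?D) ^ m * 3 powr ((\<theta> - 1) * real j * real m)))"
          using mult_left_mono[OF 2, of "3 ^ (j * (m - n)) / real (card ?D) ^ m"] by simp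
        also have "\<dots> = 3 ^ (j * (m - n)) * 3 powr ((\<theta> - 1) * real j * real m) * (\<alpha> powr (- s) * \<rho> powr s)"
          using cardD by simp
        also have "3 ^ (j * (m - n)) * 3 powr ((\<theta> - 1) * real j * real m)
            = 3 powr (real (j * (m - n)) + (\<theta> - 1) * real j * real m)"
          unfolding powr_add by (subst powr_realpow) auto
        also have "\<dots> \<le> 3 powr (\<theta> * real j)" using exp by (intro powr_mono) auto
        finally show ?thesis by (simp add: mult_ac mult_left_mono mult_right_mono)
      qed
      have "real (card {W \<in> words ?D T. zword a (concat W) 0 \<in> V}) \<le> C * \<rho> powr s * real (card (words ?D T))"
        if T: "m \<le> T" and V: "\<forall>x\<in>V. \<forall>y\<in>V. dist x y \<le> \<rho>" for T V
      proof -
        have "dist x y \<le> a ^ (k * n)" if "x \<in> V" "y \<in> V" for x y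
          using V that \<rho>n by (force simp: \<alpha>_def power_mult)
        from of_nat_mono[OF card_typed_words_met[OF k m(1) T m(2,3) this, where j = j], where 'a = real]
        have "real (card {W \<in> words ?D T. zword a (concat W) 0 \<in> V})
           \<le> c * (3 ^ (j * (m - n)) * real (card ?D) ^ (T - m))" by (simp add: c_def)
        also have "real (card ?D) ^ (T - m) = real (card ?D) ^ T / real (card ?D) ^ m"
          using T cardD by (simp add: power_diff)
        also have "c * (3 ^ (j * (m - n)) * (real (card ?D) ^ T / real (card ?D) ^ m))
          = c * (3 ^ (j * (m - n)) / real (card ?D) ^ m) * real (card ?D) ^ T" by simp
        also have "\<dots> \<le> c * (3 powr (\<theta> * real j) * \<alpha> powr (- s) * \<rho> powr s) * real (card ?D) ^ T"
          using key c0 by (intro mult_right_mono mult_left_mono) auto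
        also have "\<dots> = c * 3 powr (\<theta> * real j) * \<alpha> powr (- s) * (\<rho> powr s * real (card ?D) ^ T)"
          by (simp add: mult_ac)
        also have "\<dots> \<le> C * (\<rho> powr s * real (card ?D) ^ T)"
          by (intro mult_right_mono) (auto simp: C_def)
        finally show ?thesis by (simp add: card_words finite_typed_words mult_ac)
      qed
      then show ?thesis by blast
    qed
  qed
qed

lemma hausdorff_dim_Lambda: "hausdorff_dim (Lambda a) = ereal hdim"
  using hdim_pos hausdorff_measure_above_hdim hausdorff_measure_below_hdim
  by (intro hausdorff_dim_eqI) auto

end

section \<open>Comparison of the dimensions and dependence on the parameter\<close>

text \<open>Weighted arithmetic-geometric mean inequality for \<open>x\<close> and 1, obtained from \<open>ln u \<le> u - 1\<close> at
  \<open>u = x / y\<close> and at \<open>u = 1 / y\<close>, where \<open>y\<close> is the weighted arithmetic mean.\<close>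

lemma powr_less_tangent:
  fixes x t :: real
  assumes "0 < x" "x \<noteq> 1" "0 < t" "t < 1"
  shows "x powr t < 1 + t * (x - 1)"
proof -
  define y where "y = 1 + t * (x - 1)"
  have y: "0 < y"
  proof -
    have "y = (1 - t) + t * x" by (simp add: y_def algebra_simps)
    then show ?thesis using assms by (simp add: add_pos_pos)
  qed
  have "ln (x / y) \<le> x / y - 1" "ln (1 / y) \<le> 1 / y - 1"
    using assms y by (auto intro!: ln_le_minus_one)
  moreover have "ln (1 / y) \<noteq> 1 / y - 1"
    using ln_eq_minus_one[of "1 / y"] y assms by (auto simp: y_def)
  ultimately have "t * ln (x / y) + (1 - t) * ln (1 / y) < t * (x / y - 1) + (1 - t) * (1 / y - 1)"
    using assms by (intro add_le_less_mono mult_left_mono mult_strict_left_mono) auto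
  also have "\<dots> = ((1 - t) + t * x) / y - 1" using y by (simp add: field_simps)
  also have "\<dots> = 0" using y by (simp add: y_def algebra_simps)
  finally have "t * ln x < ln y"
    using assms y by (simp add: ln_div algebra_simps)
  then have "exp (t * ln x) < exp (ln y)" by simp
  also have "exp (ln y) = y" using y by simp
  finally show ?thesis using assms(1) unfolding y_def[symmetric] by (simp add: powr_def)
qed

text \<open>The column sizes relative to their mean \<open>5/3\<close> are \<open>3/5, 9/5, 3/5\<close>, with mean 1. By strict
  concavity the mean of their powers with exponent \<open>\<theta>\<close> is below 1, that is,
  \<open>2 + 3 powr \<theta> < 3 * (5/3) powr \<theta>\<close>.\<close>

lemma (in zipper) hdim_less_box_dim: "hdim < 1 + ln (3/5) / ln a"
proof -
  have "ln a < - ln 3"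
  proof -
    have "ln a < ln (1/3)" using a_pos a_le by (subst ln_less_cancel_iff) auto
    then show ?thesis by (simp add: ln_div)
  qed
  then have t: "\<theta> < 1" unfolding \<theta>_def using ln_a_neg by (subst pos_divide_less_eq) auto
  have "2 * (3/5) powr \<theta> + (9/5) powr \<theta> < 2 * (1 + \<theta> * (3/5 - 1)) + (1 + \<theta> * (9/5 - 1))"
    using powr_less_tangent[of "3/5" \<theta>] powr_less_tangent[of "9/5" \<theta>] theta_pos t by simp
  also have "\<dots> = 3" by (simp add: field_simps)
  finally have "(5/3) powr \<theta> * (2 * (3/5) powr \<theta> + (9/5) powr \<theta>) < (5/3) powr \<theta> * 3" by simp
  then have "2 * ((5/3) powr \<theta> * (3/5) powr \<theta>) + (5/3) powr \<theta> * (9/5) powr \<theta> < 3 * (5/3) powr \<theta>"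
    by (simp add: algebra_simps)
  then have "Z < 3 * (5/3) powr \<theta>"
    by (simp add: Z_def powr_mult[symmetric])
  then have "ln Z < ln (3 * (5/3) powr \<theta>)" using Z_gt_2 by (subst ln_less_cancel_iff) auto
  also have "\<dots> = ln 3 + \<theta> * ln (5/3)" by (simp add: ln_mult ln_powr)
  finally have "hdim < 1 + \<theta> * ln (5/3) / ln 3" by (simp add: hdim_def field_simps)
  also have "\<theta> * ln (5/3) / ln 3 = ln (3/5) / ln a"
    using ln_a_neg by (simp add: \<theta>_def ln_div field_simps)
  finally show ?thesis .
qed

lemma ln_parameter:
  assumes "a \<in> {0<..1/5::real}"
  shows "ln a < 0"
  using assms by simp

theorem proposition8p5:
  "(\<forall>a\<in>{0<..1/5::real}.
      ereal (1 / ln 3 * ln (2 + 3 powr (ln 3 / (- ln a)))) = hausdorff_dim (Lambda a) \<and>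
      hausdorff_dim (Lambda a) < box_dim (Lambda a) \<and>
      has_box_dim (Lambda a) \<and>
      box_dim (Lambda a) = ereal (1 + ln (3/5) / ln a)) \<and>
   continuous_on {0<..1/5::real} (\<lambda>a. 1 / ln 3 * ln (2 + 3 powr (ln 3 / (- ln a)))) \<and>
   strict_mono_on {0<..1/5::real} (\<lambda>a. 1 / ln 3 * ln (2 + 3 powr (ln 3 / (- ln a)))) \<and>
   continuous_on {0<..1/5::real} (\<lambda>a. 1 + ln (3/5) / ln a) \<and>
   strict_mono_on {0<..1/5::real} (\<lambda>a. 1 + ln (3/5) / ln a)"
proof (intro conjI ballI)
  fix a :: real assume a: "a \<in> {0<..1/5}"
  then interpret zipper a by unfold_locales auto
  have H: "hausdorff_dim (Lambda a) = ereal (1 / ln 3 * ln (2 + 3 powr (ln 3 / (- ln a))))"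
    by (simp only: hausdorff_dim_Lambda hdim_def Z_def \<theta>_def)
  have B: "box_dim (Lambda a) = ereal (1 + ln (3/5) / ln a)" "has_box_dim (Lambda a)"
    by (rule box_dim_eqI[OF box_dim_limit])+
  show "ereal (1 / ln 3 * ln (2 + 3 powr (ln 3 / (- ln a)))) = hausdorff_dim (Lambda a)"
    by (rule H[symmetric])
  show "hausdorff_dim (Lambda a) < box_dim (Lambda a)"
    unfolding hausdorff_dim_Lambda B(1) using hdim_less_box_dim by simp
  show "has_box_dim (Lambda a)" "box_dim (Lambda a) = ereal (1 + ln (3/5) / ln a)" by (fact B)+
next
  show "continuous_on {0<..1/5::real} (\<lambda>a. 1 / ln 3 * ln (2 + 3 powr (ln 3 / (- ln a))))"
  proof -
    have "2 + 3 powr t \<noteq> 0" for t :: real using powr_ge_zero[of 3 t] by linarith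
    then show ?thesis using ln_parameter by (intro continuous_intros) auto
  qed
  show "continuous_on {0<..1/5::real} (\<lambda>a. 1 + ln (3/5) / ln a)"
    using ln_parameter by (intro continuous_intros) auto
  have inv: "1 / (- ln x) < 1 / (- ln y)" if "x \<in> {0<..1/5}" "y \<in> {0<..1/5}" "x < y" for x y :: real
    using that ln_parameter[of x] ln_parameter[of y] by (intro divide_strict_left_mono) (auto simp: mult_neg_neg)
  show "strict_mono_on {0<..1/5::real} (\<lambda>a. 1 / ln 3 * ln (2 + 3 powr (ln 3 / (- ln a))))"
  proof (rule strict_mono_onI)
    fix x y :: real assume xy: "x \<in> {0<..1/5}" "y \<in> {0<..1/5}" "x < y"
    have "ln 3 * (1 / (- ln x)) < ln 3 * (1 / (- ln y))" using inv[OF xy] by (intro mult_strict_left_mono) auto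
    then have "2 + 3 powr (ln 3 / (- ln x)) < 2 + 3 powr (ln 3 / (- ln y))" by simp
    then have "ln (2 + 3 powr (ln 3 / (- ln x))) < ln (2 + 3 powr (ln 3 / (- ln y)))"
      by (subst ln_less_cancel_iff) (auto simp: add_pos_pos)
    then show "1 / ln 3 * ln (2 + 3 powr (ln 3 / (- ln x))) < 1 / ln 3 * ln (2 + 3 powr (ln 3 / (- ln y)))"
      by (intro mult_strict_left_mono) auto
  qed
  show "strict_mono_on {0<..1/5::real} (\<lambda>a. 1 + ln (3/5) / ln a)"
  proof (rule strict_mono_onI)
    fix x y :: real assume xy: "x \<in> {0<..1/5}" "y \<in> {0<..1/5}" "x < y"
    have "(- ln (3/5)) * (1 / (- ln x)) < (- ln (3/5)) * (1 / (- ln y))"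
      using inv[OF xy] by (intro mult_strict_left_mono) auto
    then show "1 + ln (3/5) / ln x < 1 + ln (3/5) / ln y" by simp
  qed
qed

end
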